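(* There is a polynomial-time algorithm that solves the Stochastic Boolean Function Evaluation (SBFE) problem for CDNF formulas with approximation factor $O(\log kd)$, where $k$ is the number of clauses in the CNF formula and $d$ is the number of terms in the DNF formula of the input CDNF formula. That is, on every input (CDNF formula, probability vector $p$, cost vector $c$), the expected testing cost of the algorithm is at most $O(\log kd)$ times the minimum expected testing cost of any strategy evaluating the function.
   Context: Stochastic Boolean Function Evaluation (SBFE): the input is a representation of a Boolean function $f:\{0,1\}^n\to\{0,1\}$ from a fixed class, a probability vector $p=(p_1,\dots,p_n)$ with $0<p_i<1$, and a cost vector $c=(c_1,\dots,c_n)$ with $c_i\ge 0$. An unknown input $x\in\{0,1\}^n$ is drawn from the product distribution $D_p$ with $\Pr[x_i=1]=p_i$. The value of $x_i$ can be learned only by "testing" $i$ at cost $c_i$. A strategy (adaptive decision tree) tests variables sequentially, the choice of next test possibly depending on previous outcomes, and must continue until the observed partial assignment $b\in\{0,1,*\}^n$ ($b_i=*$ meaning untested) is a $0$-certificate or a $1$-certificate of $f$, then outputs $f(x)$. Here $b$ is a $0$-certificate ($1$-certificate) if $f(a)=0$ ($f(a)=1$) for every $a\in\{0,1\}^n$ agreeing with $b$ on all coordinates where $b_i\ne *$. The cost of a strategy is its expected total testing cost for $x\sim D_p$; an optimal strategy minimizes this. The running time of an algorithm is the worst-case time it takes to determine the next variable to test or to compute the output after the last test. A CDNF formula for $f$ is a pair $(\phi_0,\phi_1)$ where $\phi_0$ is a CNF formula and $\phi_1$ is a DNF formula, both representing $f$. *)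

theory Defs
  imports
    "HOL-Probability.Product_PMF"
    "HOL-Library.Landau_Symbols"
    "HOL-Library.Discrete_Functions"
    "HOL-Computational_Algebra.Polynomial"
begin

section \<open>Strategies for Boolean function evaluation\<close>

text \<open>
  Assignments in \<open>{0,1}\<^sup>n\<close> are functions \<open>nat \<Rightarrow> bool\<close> of which only the coordinates below \<open>n\<close>
  matter; partial assignments in \<open>{0,1,*}\<^sup>n\<close> are functions \<open>nat \<Rightarrow> bool option\<close>, with
  \<open>None\<close> for \<open>*\<close>.
\<close>

type_synonym assignment = "nat \<Rightarrow> bool"
type_synonym partial_assignment = "nat \<Rightarrow> bool option"

definition agrees :: "nat \<Rightarrow> assignment \<Rightarrow> partial_assignment \<Rightarrow> bool" where
  "agrees n a b \<longleftrightarrow> (\<forall>i<n. \<forall>v. b i = Some v \<longrightarrow> a i = v)"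

definition certificate ::
  "nat \<Rightarrow> (assignment \<Rightarrow> bool) \<Rightarrow> bool \<Rightarrow> partial_assignment \<Rightarrow> bool" where
  "certificate n f v b \<longleftrightarrow> (\<forall>a. agrees n a b \<longrightarrow> f a = v)"

text \<open>In \<open>Test i l r\<close> the strategy continues with \<open>l\<close> if \<open>x\<^sub>i = 0\<close> and with \<open>r\<close> if \<open>x\<^sub>i = 1\<close>.\<close>

datatype dtree = Leaf bool | Test nat dtree dtree

fun strategy_from ::
  "nat \<Rightarrow> (assignment \<Rightarrow> bool) \<Rightarrow> partial_assignment \<Rightarrow> dtree \<Rightarrow> bool" where
  "strategy_from n f b (Leaf v) \<longleftrightarrow> certificate n f v b"
| "strategy_from n f b (Test i l r) \<longleftrightarrow>
     i < n \<and> b i = None \<and> \<not> certificate n f False b \<and> \<not> certificate n f True b \<and>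
     strategy_from n f (b(i := Some False)) l \<and> strategy_from n f (b(i := Some True)) r"

abbreviation unobserved :: partial_assignment where
  "unobserved \<equiv> \<lambda>_. None"

definition strategy :: "nat \<Rightarrow> (assignment \<Rightarrow> bool) \<Rightarrow> dtree \<Rightarrow> bool" where
  "strategy n f T \<longleftrightarrow> strategy_from n f unobserved T"

fun testing_cost :: "(nat \<Rightarrow> real) \<Rightarrow> dtree \<Rightarrow> assignment \<Rightarrow> real" where
  "testing_cost c (Leaf v) x = 0"
| "testing_cost c (Test i l r) x = c i + testing_cost c (if x i then r else l) x"

definition input_dist :: "nat \<Rightarrow> (nat \<Rightarrow> real) \<Rightarrow> assignment pmf" where
  "input_dist n p = Pi_pmf {..<n} False (\<lambda>i. bernoulli_pmf (p i))"

definition expected_cost :: "nat \<Rightarrow> (nat \<Rightarrow> real) \<Rightarrow> (nat \<Rightarrow> real) \<Rightarrow> dtree \<Rightarrow> real" where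
  "expected_cost n p c T = measure_pmf.expectation (input_dist n p) (testing_cost c T)"

definition opt_cost ::
  "nat \<Rightarrow> (assignment \<Rightarrow> bool) \<Rightarrow> (nat \<Rightarrow> real) \<Rightarrow> (nat \<Rightarrow> real) \<Rightarrow> real" where
  "opt_cost n f p c = Inf (expected_cost n p c ` {T. strategy n f T})"

text \<open>The infimum is attained, because there are only finitely many strategies and at least one.\<close>

lemma finite_strategies_from: "finite {T. strategy_from n f b T}"
proof (induction "card {i. i < n \<and> b i = None}" arbitrary: b rule: less_induct)
  case less
  let ?S = "\<lambda>b. {T. strategy_from n f b T}" and ?U = "{i. i < n \<and> b i = None}"
  have fin: "finite (?S (b(i := Some v)))" if "i \<in> ?U" for i v
  proof (rule less)
    have "{j. j < n \<and> (b(i := Some v)) j = None} \<subset> ?U"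
      using that by auto
    then show "card {j. j < n \<and> (b(i := Some v)) j = None} < card ?U"
      by (intro psubset_card_mono) auto
  qed
  have "?S b \<subseteq> range Leaf \<union>
      (\<Union>i\<in>?U. (\<lambda>(l, r). Test i l r) ` (?S (b(i := Some False)) \<times> ?S (b(i := Some True))))"
  proof
    fix T assume "T \<in> ?S b"
    then show "T \<in> range Leaf \<union>
      (\<Union>i\<in>?U. (\<lambda>(l, r). Test i l r) ` (?S (b(i := Some False)) \<times> ?S (b(i := Some True))))"
      by (cases T) auto
  qed
  moreover have "finite (range Leaf \<union>
      (\<Union>i\<in>?U. (\<lambda>(l, r). Test i l r) ` (?S (b(i := Some False)) \<times> ?S (b(i := Some True)))))"
    using fin by (intro finite_UnI finite_UN_I finite_imageI finite_cartesian_product) auto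
  ultimately show ?case
    by (rule finite_subset)
qed

lemma strategies_from_nonempty:
  assumes local: "\<And>a a'. (\<forall>i<n. a i = a' i) \<Longrightarrow> f a = f a'"
  shows "\<exists>T. strategy_from n f b T"
proof (induction "card {i. i < n \<and> b i = None}" arbitrary: b rule: less_induct)
  case less
  let ?U = "{i. i < n \<and> b i = None}"
  show ?case
  proof (cases "\<exists>v. certificate n f v b")
    case True
    then obtain v where "certificate n f v b" ..
    then have "strategy_from n f b (Leaf v)" by simp
    then show ?thesis ..
  next
    case False
    have "\<exists>i. i \<in> ?U"
    proof (rule ccontr)
      assume "\<not> (\<exists>i. i \<in> ?U)"
      then have *: "\<forall>i<n. \<exists>v. b i = Some v" by auto
      have "certificate n f (f (\<lambda>i. the (b i))) b"
        unfolding certificate_def agrees_def using * by (auto intro!: local)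
      with False show False by blast
    qed
    then obtain i where i: "i \<in> ?U" ..
    have "\<exists>T. strategy_from n f (b(i := Some v)) T" for v
    proof (rule less)
      have "{j. j < n \<and> (b(i := Some v)) j = None} \<subset> ?U"
        using i by auto
      then show "card {j. j < n \<and> (b(i := Some v)) j = None} < card ?U"
        by (intro psubset_card_mono) auto
    qed
    then obtain l r where "strategy_from n f (b(i := Some False)) l"
      "strategy_from n f (b(i := Some True)) r" by blast
    then have "strategy_from n f b (Test i l r)"
      using i False by auto
    then show ?thesis ..
  qed
qed

lemma opt_cost_attained:
  assumes "\<And>a a'. (\<forall>i<n. a i = a' i) \<Longrightarrow> f a = f a'"
  obtains T where "strategy n f T" "expected_cost n p c T = opt_cost n f p c"
    "\<And>T'. strategy n f T' \<Longrightarrow> expected_cost n p c T \<le> expected_cost n p c T'"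
proof -
  let ?C = "expected_cost n p c ` {T. strategy n f T}"
  have fin: "finite ?C"
    using finite_strategies_from unfolding strategy_def by blast
  have ne: "?C \<noteq> {}"
    using strategies_from_nonempty[of n f, OF assms] unfolding strategy_def by blast
  have eq: "opt_cost n f p c = Min ?C"
    unfolding opt_cost_def using fin ne by (rule cInf_eq_Min)
  obtain T where "strategy n f T" "expected_cost n p c T = Min ?C"
    using Min_in[OF fin ne] by auto
  then show thesis
    using that[of T] eq Min_le[OF fin] by auto
qed


section \<open>CDNF formulas and problem instances\<close>

text \<open>The literal \<open>(i, True)\<close> is \<open>x\<^sub>i\<close>, and \<open>(i, False)\<close> is its negation.\<close>

type_synonym literal = "nat \<times> bool"

definition lit_true :: "assignment \<Rightarrow> literal \<Rightarrow> bool" where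
  "lit_true a l \<longleftrightarrow> a (fst l) = snd l"

definition eval_cnf :: "literal list list \<Rightarrow> assignment \<Rightarrow> bool" where
  "eval_cnf \<phi> a \<longleftrightarrow> (\<forall>C\<in>set \<phi>. \<exists>l\<in>set C. lit_true a l)"

definition eval_dnf :: "literal list list \<Rightarrow> assignment \<Rightarrow> bool" where
  "eval_dnf \<phi> a \<longleftrightarrow> (\<exists>t\<in>set \<phi>. \<forall>l\<in>set t. lit_true a l)"

text \<open>The numbers in the input of an algorithm are rational, so that they have a finite encoding.\<close>

record sbfe_instance =
  cnf :: "literal list list"
  dnf :: "literal list list"
  probs :: "rat list"
  costs :: "rat list"

definition num_vars :: "sbfe_instance \<Rightarrow> nat" where
  "num_vars I = length (probs I)"

definition prob_of :: "sbfe_instance \<Rightarrow> nat \<Rightarrow> real" where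
  "prob_of I i = of_rat (probs I ! i)"

definition cost_of :: "sbfe_instance \<Rightarrow> nat \<Rightarrow> real" where
  "cost_of I i = of_rat (costs I ! i)"

definition cdnf_instance :: "sbfe_instance \<Rightarrow> bool" where
  "cdnf_instance I \<longleftrightarrow>
     (\<forall>C\<in>set (cnf I). \<forall>l\<in>set C. fst l < num_vars I) \<and>
     (\<forall>t\<in>set (dnf I). \<forall>l\<in>set t. fst l < num_vars I) \<and>
     (\<forall>a. eval_cnf (cnf I) a = eval_dnf (dnf I) a) \<and>
     (\<forall>q\<in>set (probs I). 0 < q \<and> q < 1) \<and>
     length (costs I) = num_vars I \<and>
     (\<forall>q\<in>set (costs I). 0 \<le> q)"

definition fun_of :: "sbfe_instance \<Rightarrow> assignment \<Rightarrow> bool" where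
  "fun_of I = eval_cnf (cnf I)"


section \<open>Model of computation\<close>

text \<open>
  Programs are finite systems of mutually recursive first-order functions with call-by-value
  semantics, operating on binary trees with natural numbers at the leaves. The running time is
  counted under the logarithmic cost criterion: every access to and every operation on data is
  charged with the size of the operands, a number contributing its length in binary. The results of
  all operations are at most linearly longer than their operands, and each operation is computable
  in polynomial time, so polynomial time in this model is polynomial time on Turing machines.
\<close>

datatype val = Num nat | Cell val val

fun val_size :: "val \<Rightarrow> nat" where
  "val_size (Num m) = floor_log m + 1"
| "val_size (Cell u v) = val_size u + val_size v + 1"

datatype op1 = IsCell | First | Second

datatype op2 = MkCell | Add | Sub | Mul | Leq

fun num :: "val \<Rightarrow> nat" where
  "num (Num m) = m"
| "num (Cell u v) = 0"

fun apply1 :: "op1 \<Rightarrow> val \<Rightarrow> val" where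
  "apply1 IsCell (Cell u v) = Num 1"
| "apply1 First (Cell u v) = u"
| "apply1 Second (Cell u v) = v"
| "apply1 _ (Num m) = Num 0"

fun apply2 :: "op2 \<Rightarrow> val \<Rightarrow> val \<Rightarrow> val" where
  "apply2 MkCell u v = Cell u v"
| "apply2 Add u v = Num (num u + num v)"
| "apply2 Sub u v = Num (num u - num v)"
| "apply2 Mul u v = Num (num u * num v)"
| "apply2 Leq u v = Num (if num u \<le> num v then 1 else 0)"

text \<open>
  \<open>EVar i\<close> is the \<open>i\<close>-th entry of the environment, \<open>ELet e e'\<close> evaluates \<open>e'\<close> in the environment
  extended at the front by the value of \<open>e\<close>, and \<open>ECall j e\<close> applies the \<open>j\<close>-th function of the
  program. A program is the list of its function bodies, each with the argument as its only
  variable; it is started with function \<open>0\<close>.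
\<close>

datatype expr =
    ENum nat
  | EVar nat
  | EOp1 op1 expr
  | EOp2 op2 expr expr
  | EIf expr expr expr
  | ELet expr expr
  | ECall nat expr

type_synonym program = "expr list"

text \<open>\<open>eval P \<rho> e v t\<close>: in environment \<open>\<rho>\<close>, expression \<open>e\<close> evaluates to \<open>v\<close> in time \<open>t\<close>.\<close>

inductive eval :: "program \<Rightarrow> val list \<Rightarrow> expr \<Rightarrow> val \<Rightarrow> nat \<Rightarrow> bool" for P where
  eval_Num: "eval P \<rho> (ENum m) (Num m) (val_size (Num m))"
| eval_Var: "i < length \<rho> \<Longrightarrow> eval P \<rho> (EVar i) (\<rho> ! i) (val_size (\<rho> ! i))"
| eval_Op1: "eval P \<rho> e u t \<Longrightarrow>
    eval P \<rho> (EOp1 g e) (apply1 g u) (t + val_size u + 1)"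
| eval_Op2: "eval P \<rho> e u t \<Longrightarrow> eval P \<rho> e' u' t' \<Longrightarrow>
    eval P \<rho> (EOp2 g e e') (apply2 g u u') (t + t' + val_size u + val_size u' + 1)"
| eval_If_true: "eval P \<rho> e u t \<Longrightarrow> u \<noteq> Num 0 \<Longrightarrow> eval P \<rho> e1 v t' \<Longrightarrow>
    eval P \<rho> (EIf e e1 e2) v (t + t' + 1)"
| eval_If_false: "eval P \<rho> e (Num 0) t \<Longrightarrow> eval P \<rho> e2 v t' \<Longrightarrow>
    eval P \<rho> (EIf e e1 e2) v (t + t' + 1)"
| eval_Let: "eval P \<rho> e u t \<Longrightarrow> eval P (u # \<rho>) e' v t' \<Longrightarrow>
    eval P \<rho> (ELet e e') v (t + t' + 1)"
| eval_Call: "eval P \<rho> e u t \<Longrightarrow> j < length P \<Longrightarrow> eval P [u] (P ! j) v t' \<Longrightarrow>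
    eval P \<rho> (ECall j e) v (t + t' + 1)"

lemma eval_deterministic:
  "eval P \<rho> e v t \<Longrightarrow> eval P \<rho> e v' t' \<Longrightarrow> v = v' \<and> t = t'"
proof (induction arbitrary: v' t' rule: eval.induct)
  case eval_Num
  then show ?case by (auto elim: eval.cases)
next
  case eval_Var
  from eval_Var.prems show ?case by cases auto
next
  case eval_Op1
  from eval_Op1.prems show ?case by cases (use eval_Op1.IH in blast)
next
  case eval_Op2
  from eval_Op2.prems show ?case by cases (use eval_Op2.IH in blast)
next
  case eval_If_true
  from eval_If_true.prems show ?case by cases (use eval_If_true in blast)+
next
  case eval_If_false
  from eval_If_false.prems show ?case by cases (use eval_If_false in blast)+
next
  case eval_Let
  from eval_Let.prems show ?case by cases (use eval_Let.IH in blast)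
next
  case eval_Call
  from eval_Call.prems show ?case by cases (use eval_Call.IH in blast)
qed

definition computes_within :: "program \<Rightarrow> val \<Rightarrow> val \<Rightarrow> nat \<Rightarrow> bool" where
  "computes_within P u v B \<longleftrightarrow> P \<noteq> [] \<and> (\<exists>t\<le>B. eval P [u] (P ! 0) v t)"


section \<open>Algorithms for the evaluation problem\<close>

fun enc_list :: "('a \<Rightarrow> val) \<Rightarrow> 'a list \<Rightarrow> val" where
  "enc_list g [] = Num 0"
| "enc_list g (x # xs) = Cell (g x) (enc_list g xs)"

definition enc_bool :: "bool \<Rightarrow> val" where
  "enc_bool v = Num (if v then 1 else 0)"

definition enc_literal :: "literal \<Rightarrow> val" where
  "enc_literal l = Cell (Num (fst l)) (enc_bool (snd l))"

text \<open>Numerator and denominator in lowest terms; only used for nonnegative numbers.\<close>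

definition enc_rat :: "rat \<Rightarrow> val" where
  "enc_rat q = Cell (Num (nat (fst (quotient_of q)))) (Num (nat (snd (quotient_of q))))"

definition enc_instance :: "sbfe_instance \<Rightarrow> val" where
  "enc_instance I =
     Cell (Cell (enc_list (enc_list enc_literal) (cnf I)) (enc_list (enc_list enc_literal) (dnf I)))
          (Cell (enc_list enc_rat (probs I)) (enc_list enc_rat (costs I)))"

definition instance_size :: "sbfe_instance \<Rightarrow> nat" where
  "instance_size I = val_size (enc_instance I)"

fun enc_entry :: "bool option \<Rightarrow> val" where
  "enc_entry None = Num 0"
| "enc_entry (Some False) = Num 1"
| "enc_entry (Some True) = Num 2"

definition enc_partial :: "nat \<Rightarrow> partial_assignment \<Rightarrow> val" where
  "enc_partial n b = enc_list enc_entry (map b [0..<n])"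

datatype action = Query nat | Output bool

fun enc_action :: "action \<Rightarrow> val" where
  "enc_action (Query i) = Cell (Num 0) (Num i)"
| "enc_action (Output v) = Cell (Num 1) (enc_bool v)"

text \<open>
  An algorithm is a program that, given the instance and the outcomes observed so far, computes
  either the next variable to test or the output. \<open>executes P B I b T\<close> states that, once \<open>b\<close> has
  been observed, \<open>P\<close> on instance \<open>I\<close> tests and answers as the decision tree \<open>T\<close> does, and spends time
  at most \<open>B\<close> on each of these decisions, whatever the outcomes are.
\<close>

inductive executes ::
  "program \<Rightarrow> nat \<Rightarrow> sbfe_instance \<Rightarrow> partial_assignment \<Rightarrow> dtree \<Rightarrow> bool" for P B I where
  executes_Leaf:
    "computes_within P (Cell (enc_instance I) (enc_partial (num_vars I) b))
       (enc_action (Output v)) B \<Longrightarrow>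
     executes P B I b (Leaf v)"
| executes_Test:
    "computes_within P (Cell (enc_instance I) (enc_partial (num_vars I) b))
       (enc_action (Query i)) B \<Longrightarrow>
     executes P B I (b(i := Some False)) l \<Longrightarrow>
     executes P B I (b(i := Some True)) r \<Longrightarrow>
     executes P B I b (Test i l r)"

text \<open>
  \<open>P\<close> evaluates every instance with a correct strategy whose expected cost is within the factor
  \<open>\<alpha> I\<close> of the optimum, in time polynomial in the size of the instance.
\<close>

definition polytime_cdnf_approximation ::
  "program \<Rightarrow> (sbfe_instance \<Rightarrow> real) \<Rightarrow> bool" where
  "polytime_cdnf_approximation P \<alpha> \<longleftrightarrow>
     (\<exists>q :: nat poly. \<forall>I. cdnf_instance I \<longrightarrow>
        (\<exists>T. executes P (poly q (instance_size I)) I unobserved T \<and>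
             strategy (num_vars I) (fun_of I) T \<and>
             expected_cost (num_vars I) (prob_of I) (cost_of I) T
               \<le> \<alpha> I * opt_cost (num_vars I) (fun_of I) (prob_of I) (cost_of I)))"

end

theory Submission
  imports Defs "HOL-Analysis.Harmonic_Numbers"
begin

text \<open>
  Let \<open>R b\<close> be the number of non-tautological clauses not satisfied by \<open>b\<close> times the number of
  non-contradictory terms not falsified by \<open>b\<close>. Then \<open>R b = 0\<close> iff \<open>b\<close> is a certificate, and the
  decrease of \<open>R\<close> caused by an observation is submodular. The algorithm tests the variable \<open>j\<close> of
  minimal ratio of cost to expected decrease of \<open>R\<close>.

  Its expected cost from \<open>b\<close> is at most \<open>H (R b)\<close> times the cost \<open>W b\<close> of any strategy \<open>\<pi>\<close>, where
  \<open>H\<close> is the harmonic number, by induction on the greedy tree: let \<open>q\<close> be the probability that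
  \<open>\<pi>\<close> tests \<open>j\<close>, and \<open>u\<close> the expected cost of \<open>\<pi>\<close> stopped when it is about to test \<open>j\<close>. Once the
  outcome of \<open>j\<close> is known, \<open>\<pi>\<close> costs at least \<open>u\<close> for either outcome, and \<open>W b - q c\<^sub>j\<close> on average.
  The stopped strategy brings \<open>R\<close> down to \<open>0\<close> with probability at least \<open>1 - q\<close> and its tests are
  no more cost-effective than \<open>j\<close>, so \<open>(1 - q) c\<^sub>j\<close> is at most \<open>u\<close> times the expected relative
  decrease of \<open>R\<close>. The drop of \<open>H\<close> pays for this part of \<open>c\<^sub>j\<close>, and \<open>H (R b) \<ge> 1\<close> pays for
  \<open>q c\<^sub>j\<close>.
\<close>

section \<open>Polynomial time in the model of computation\<close>

lemma poly_nat_mono: "x \<le> y \<Longrightarrow> poly q x \<le> poly q y" for q :: "nat poly"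
  by (induction q) (auto intro!: add_mono mult_mono)

section \<open>Sizes of values under the primitive operations\<close>

lemma val_size_pos: "0 < val_size v"
  by (cases v) auto

lemma val_size_Num_num: "val_size (Num (num v)) \<le> val_size v"
  using val_size_pos[of v] by (cases v) (auto simp: floor_log_zero)

lemma floor_log_mono_nat: "m \<le> n \<Longrightarrow> floor_log m \<le> floor_log n"
  using floor_log_mono by (auto simp: mono_def)

lemma less_two_power_val_size: "m < 2 ^ val_size (Num m)"
proof (cases "m = 0")
  case False
  then show ?thesis using floor_log_exp2_gt[of m] by simp
qed simp

lemma val_size_Num_le: "m < 2 ^ k \<Longrightarrow> 0 < k \<Longrightarrow> val_size (Num m) \<le> k"
proof (cases "m = 0")
  case False
  assume "m < 2 ^ k" "0 < k"
  with False have "2 ^ floor_log m < (2::nat) ^ k"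
    using floor_log_exp2_le[of m] by linarith
  then show ?thesis by simp
qed (simp add: floor_log_zero)

lemma val_size_apply1: "val_size (apply1 g u) \<le> val_size u"
  by (cases g; cases u) (auto simp: floor_log_zero)

lemma val_size_apply2: "val_size (apply2 g u v) \<le> val_size u + val_size v + 1"
proof -
  let ?m = "num u" and ?n = "num v"
  let ?s = "val_size (Num ?m)" and ?t = "val_size (Num ?n)"
  have m: "?m < 2 ^ ?s" and n: "?n < 2 ^ ?t"
    by (rule less_two_power_val_size)+
  have st: "0 < ?s" "0 < ?t" by simp_all
  have le: "?s \<le> val_size u" "?t \<le> val_size v" by (rule val_size_Num_num)+
  have "?m + ?n < 2 ^ (?s + ?t)"
  proof -
    have "?m \<le> 2 ^ ?s - 1" "?n \<le> 2 ^ ?t - 1" using m n by linarith+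
    \<comment> \<open>With \<open>A = 2 ^ ?s\<close> and \<open>B = 2 ^ ?t\<close> this is
      \<open>(A - 1) * (B - 1) \<ge> 0\<close>.\<close>
    moreover have "(2::nat) ^ ?s + 2 ^ ?t \<le> 2 ^ (?s + ?t) + 1"
    proof -
      obtain a b where ab: "(2::nat) ^ ?s = a + 1" "(2::nat) ^ ?t = b + 1"
        by (metis Suc_eq_plus1 gr0_implies_Suc zero_less_numeral zero_less_power)
      show ?thesis unfolding power_add ab by simp
    qed
    ultimately show ?thesis using m n by linarith
  qed
  then have add: "val_size (Num (?m + ?n)) \<le> ?s + ?t"
    using st by (intro val_size_Num_le) auto
  have "?m * ?n < 2 ^ (?s + ?t)"
    unfolding power_add using m n by (intro mult_strict_mono') auto
  then have mul: "val_size (Num (?m * ?n)) \<le> ?s + ?t"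
    using st by (intro val_size_Num_le) auto
  have sub: "val_size (Num (?m - ?n)) \<le> ?s"
    by (simp add: floor_log_mono_nat)
  show ?thesis
    using add mul sub le val_size_pos[of u] by (cases g) (auto simp: floor_log_zero)
qed

text \<open>Every operation is charged the size of its operands plus one, and its result is no
  larger than that. Time bounds therefore double as bounds on the sizes of intermediate
  results.\<close>

lemma eval_val_size: "eval P \<rho> e v t \<Longrightarrow> val_size v \<le> t"
proof (induction rule: eval.induct)
  case (eval_Op1 \<rho> e u t g)
  then show ?case using val_size_apply1[of g u] by linarith
next
  case (eval_Op2 \<rho> e u t e' u' t' g)
  then show ?case using val_size_apply2[of g u u'] by linarith
qed auto

section \<open>Functions that run in polynomial time, and their composition\<close>

definition run :: "program \<Rightarrow> nat \<Rightarrow> val \<Rightarrow> val" where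
  "run P j u = (THE v. \<exists>t. eval P [u] (P ! j) v t)"

lemma run_eqI: "eval P [u] (P ! j) v t \<Longrightarrow> run P j u = v"
  unfolding run_def by (rule the_equality) (auto dest: eval_deterministic)

text \<open>The bound covers all values, malformed encodings included; the primitives are total, so
  composition needs no well-formedness conditions.\<close>

definition polytime :: "program \<Rightarrow> nat \<Rightarrow> bool" where
  "polytime P j \<longleftrightarrow> j < length P \<and>
     (\<exists>q :: nat poly. \<forall>u. \<exists>v t. t \<le> poly q (val_size u) \<and> eval P [u] (P ! j) v t)"

lemma polytimeE:
  assumes "polytime P j"
  obtains q :: "nat poly" where "j < length P"
    "\<And>u. \<exists>t \<le> poly q (val_size u). eval P [u] (P ! j) (run P j u) t"
    "\<And>u. val_size (run P j u) \<le> poly q (val_size u)"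
proof -
  from assms obtain q :: "nat poly" where j: "j < length P" and
    q: "\<And>u. \<exists>v t. t \<le> poly q (val_size u) \<and> eval P [u] (P ! j) v t"
    unfolding polytime_def by blast
  have *: "\<exists>t \<le> poly q (val_size u). eval P [u] (P ! j) (run P j u) t" for u
    using q[of u] run_eqI by blast
  have "val_size (run P j u) \<le> poly q (val_size u)" for u
    using *[of u] eval_val_size order_trans by blast
  with j * that show thesis by blast
qed

text \<open>\<open>J\<close> collects the functions that may be called, later those already known to
  be polynomial; \<open>n\<close> is the length of the environment.\<close>

fun scoped :: "nat set \<Rightarrow> nat \<Rightarrow> expr \<Rightarrow> bool" where
  "scoped J n (ENum m) \<longleftrightarrow> True"
| "scoped J n (EVar i) \<longleftrightarrow> i < n"
| "scoped J n (EOp1 g e) \<longleftrightarrow> scoped J n e"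
| "scoped J n (EOp2 g e e') \<longleftrightarrow> scoped J n e \<and> scoped J n e'"
| "scoped J n (EIf e e1 e2) \<longleftrightarrow> scoped J n e \<and> scoped J n e1 \<and> scoped J n e2"
| "scoped J n (ELet e e') \<longleftrightarrow> scoped J n e \<and> scoped J (Suc n) e'"
| "scoped J n (ECall j e) \<longleftrightarrow> j \<in> J \<and> scoped J n e"

text \<open>A semantics without time. Calls go to \<open>run\<close>, so the recursion is structural
  even when the called function is recursive.\<close>

fun den :: "program \<Rightarrow> val list \<Rightarrow> expr \<Rightarrow> val" where
  "den P \<rho> (ENum m) = Num m"
| "den P \<rho> (EVar i) = \<rho> ! i"
| "den P \<rho> (EOp1 g e) = apply1 g (den P \<rho> e)"
| "den P \<rho> (EOp2 g e e') = apply2 g (den P \<rho> e) (den P \<rho> e')"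
| "den P \<rho> (EIf e e1 e2) = (if den P \<rho> e \<noteq> Num 0 then den P \<rho> e1 else den P \<rho> e2)"
| "den P \<rho> (ELet e e') = den P (den P \<rho> e # \<rho>) e'"
| "den P \<rho> (ECall j e) = run P j (den P \<rho> e)"

definition env_size :: "val list \<Rightarrow> nat" where
  "env_size \<rho> = sum_list (map val_size \<rho>)"

lemma env_size_simps [simp]: "env_size [] = 0" "env_size (u # \<rho>) = val_size u + env_size \<rho>"
  by (simp_all add: env_size_def)

lemma val_size_nth_le_env_size: "i < length \<rho> \<Longrightarrow> val_size (\<rho> ! i) \<le> env_size \<rho>"
  unfolding env_size_def by (rule member_le_sum_list) auto

definition time_bound :: "program \<Rightarrow> nat \<Rightarrow> expr \<Rightarrow> nat poly \<Rightarrow> bool" where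
  "time_bound P n e q \<longleftrightarrow>
     (\<forall>\<rho>. length \<rho> = n \<longrightarrow> (\<exists>t \<le> poly q (env_size \<rho>). eval P \<rho> e (den P \<rho> e) t))"

lemma time_boundE:
  assumes "time_bound P n e q" "length \<rho> = n"
  obtains t where "eval P \<rho> e (den P \<rho> e) t" "t \<le> poly q (env_size \<rho>)"
    "val_size (den P \<rho> e) \<le> poly q (env_size \<rho>)"
proof -
  from assms obtain t where "eval P \<rho> e (den P \<rho> e) t" "t \<le> poly q (env_size \<rho>)"
    unfolding time_bound_def by blast
  then show thesis using that eval_val_size order_trans by blast
qed

lemma time_boundE_mono:
  assumes "time_bound P n e q" "length \<rho> = n" "env_size \<rho> \<le> N"
  obtains t where "eval P \<rho> e (den P \<rho> e) t" "t \<le> poly q N" "val_size (den P \<rho> e) \<le> poly q N"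
proof (rule time_boundE[OF assms(1,2)])
  fix t assume "eval P \<rho> e (den P \<rho> e) t" "t \<le> poly q (env_size \<rho>)"
    "val_size (den P \<rho> e) \<le> poly q (env_size \<rho>)"
  with poly_nat_mono[OF assms(3), of q] that show thesis by (meson order_trans)
qed

text \<open>Polynomials are closed under sums, which serve operations and branches, and under
  composition, which serves bindings and calls: there the time of the first expression also bounds
  the size of the value it hands on.\<close>

lemma scoped_time_bound:
  assumes "\<And>j. j \<in> J \<Longrightarrow> polytime P j" and "scoped J n e"
  shows "\<exists>q. time_bound P n e q"
  using assms(2)
proof (induction e arbitrary: n)
  case (ENum m)
  have "time_bound P n (ENum m) [:val_size (Num m):]"
    unfolding time_bound_def by (auto intro: eval_Num simp del: val_size.simps)
  then show ?case ..
next
  case (EVar i)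
  then have "time_bound P n (EVar i) [:0, 1:]"
    unfolding time_bound_def using val_size_nth_le_env_size eval_Var by fastforce
  then show ?case ..
next
  case (EOp1 g e)
  then obtain q where q: "time_bound P n e q" by auto
  have "time_bound P n (EOp1 g e) (q + q + [:1:])"
    unfolding time_bound_def
  proof (intro allI impI)
    fix \<rho> :: "val list" assume "length \<rho> = n"
    from time_boundE[OF q this] obtain t where
      "eval P \<rho> e (den P \<rho> e) t" "t \<le> poly q (env_size \<rho>)"
      "val_size (den P \<rho> e) \<le> poly q (env_size \<rho>)" .
    then show "\<exists>t\<le>poly (q + q + [:1:]) (env_size \<rho>).
        eval P \<rho> (EOp1 g e) (den P \<rho> (EOp1 g e)) t"
      using eval_Op1[of P \<rho> e "den P \<rho> e" t g]
      by (intro exI[of _ "t + val_size (den P \<rho> e) + 1"]) auto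
  qed
  then show ?case ..
next
  case (EOp2 g e e')
  then obtain q q' where q: "time_bound P n e q" "time_bound P n e' q'" by fastforce
  have "time_bound P n (EOp2 g e e') (q + q' + q + q' + [:1:])"
    unfolding time_bound_def
  proof (intro allI impI)
    fix \<rho> :: "val list" assume l: "length \<rho> = n"
    from time_boundE[OF q(1) l] obtain t where t:
      "eval P \<rho> e (den P \<rho> e) t" "t \<le> poly q (env_size \<rho>)"
      "val_size (den P \<rho> e) \<le> poly q (env_size \<rho>)" .
    from time_boundE[OF q(2) l] obtain t' where t':
      "eval P \<rho> e' (den P \<rho> e') t'" "t' \<le> poly q' (env_size \<rho>)"
      "val_size (den P \<rho> e') \<le> poly q' (env_size \<rho>)" .
    show "\<exists>t\<le>poly (q + q' + q + q' + [:1:]) (env_size \<rho>).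
        eval P \<rho> (EOp2 g e e') (den P \<rho> (EOp2 g e e')) t"
      using eval_Op2[OF t(1) t'(1), of g] t(2,3) t'(2,3)
      by (intro exI[of _ "t + t' + val_size (den P \<rho> e) + val_size (den P \<rho> e') + 1"]) auto
  qed
  then show ?case ..
next
  case (EIf e e1 e2)
  then obtain q q1 q2 where q: "time_bound P n e q" "time_bound P n e1 q1" "time_bound P n e2 q2"
    by fastforce
  have "time_bound P n (EIf e e1 e2) (q + q1 + q2 + [:1:])"
    unfolding time_bound_def
  proof (intro allI impI)
    fix \<rho> :: "val list" assume l: "length \<rho> = n"
    from time_boundE[OF q(1) l] obtain t where t:
      "eval P \<rho> e (den P \<rho> e) t" "t \<le> poly q (env_size \<rho>)" .
    from time_boundE[OF q(2) l] obtain t1 where t1: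
      "eval P \<rho> e1 (den P \<rho> e1) t1" "t1 \<le> poly q1 (env_size \<rho>)" .
    from time_boundE[OF q(3) l] obtain t2 where t2:
      "eval P \<rho> e2 (den P \<rho> e2) t2" "t2 \<le> poly q2 (env_size \<rho>)" .
    show "\<exists>t\<le>poly (q + q1 + q2 + [:1:]) (env_size \<rho>).
        eval P \<rho> (EIf e e1 e2) (den P \<rho> (EIf e e1 e2)) t"
    proof (cases "den P \<rho> e = Num 0")
      case True
      with eval_If_false[of P \<rho> e t e2 "den P \<rho> e2" t2 e1] t t1 t2 show ?thesis
        by (intro exI[of _ "t + t2 + 1"]) auto
    next
      case False
      with eval_If_true[OF t(1) _ t1(1), of e2] t t1 t2 show ?thesis
        by (intro exI[of _ "t + t1 + 1"]) auto
    qed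
  qed
  then show ?case ..
next
  case (ELet e e')
  then obtain q q' where q: "time_bound P n e q" "time_bound P (Suc n) e' q'" by fastforce
  have "time_bound P n (ELet e e') (q + pcompose q' (q + [:0, 1:]) + [:1:])"
    unfolding time_bound_def
  proof (intro allI impI)
    fix \<rho> :: "val list" assume l: "length \<rho> = n"
    from time_boundE[OF q(1) l] obtain t where t:
      "eval P \<rho> e (den P \<rho> e) t" "t \<le> poly q (env_size \<rho>)"
      "val_size (den P \<rho> e) \<le> poly q (env_size \<rho>)" .
    from time_boundE[OF q(2), of "den P \<rho> e # \<rho>"] l obtain t' where t':
      "eval P (den P \<rho> e # \<rho>) e' (den P (den P \<rho> e # \<rho>) e') t'"
      "t' \<le> poly q' (env_size (den P \<rho> e # \<rho>))" by auto
    have "poly q' (env_size (den P \<rho> e # \<rho>)) \<le> poly q' (poly q (env_size \<rho>) + env_size \<rho>)"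
      using t(3) by (intro poly_nat_mono) simp
    then show "\<exists>t\<le>poly (q + pcompose q' (q + [:0, 1:]) + [:1:]) (env_size \<rho>).
        eval P \<rho> (ELet e e') (den P \<rho> (ELet e e')) t"
      using eval_Let[OF t(1) t'(1)] t(2) t'(2)
      by (intro exI[of _ "t + t' + 1"]) (auto simp: poly_pcompose)
  qed
  then show ?case ..
next
  case (ECall j e)
  then obtain q where q: "time_bound P n e q" and j: "polytime P j" using assms(1) by fastforce
  from j obtain r :: "nat poly" where r: "j < length P"
    "\<And>u. \<exists>t \<le> poly r (val_size u). eval P [u] (P ! j) (run P j u) t"
    by (rule polytimeE) blast
  have "time_bound P n (ECall j e) (q + pcompose r q + [:1:])"
    unfolding time_bound_def
  proof (intro allI impI)
    fix \<rho> :: "val list" assume l: "length \<rho> = n"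
    from time_boundE[OF q(1) l] obtain t where t:
      "eval P \<rho> e (den P \<rho> e) t" "t \<le> poly q (env_size \<rho>)"
      "val_size (den P \<rho> e) \<le> poly q (env_size \<rho>)" .
    obtain t' where t': "eval P [den P \<rho> e] (P ! j) (run P j (den P \<rho> e)) t'"
      "t' \<le> poly r (val_size (den P \<rho> e))" using r(2) by blast
    have "poly r (val_size (den P \<rho> e)) \<le> poly r (poly q (env_size \<rho>))"
      by (rule poly_nat_mono[OF t(3)])
    then show "\<exists>t\<le>poly (q + pcompose r q + [:1:]) (env_size \<rho>).
        eval P \<rho> (ECall j e) (den P \<rho> (ECall j e)) t"
      using eval_Call[OF t(1) r(1) t'(1)] t(2) t'(2)
      by (intro exI[of _ "t + t' + 1"]) (auto simp: poly_pcompose)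
  qed
  then show ?case ..
qed

lemma polytime_nonrec:
  assumes "\<And>i. i \<in> J \<Longrightarrow> polytime P i" "j < length P" "scoped J 1 (P ! j)"
  shows "polytime P j"
proof -
  from scoped_time_bound[OF assms(1,3)] obtain q where q: "time_bound P 1 (P ! j) q" by blast
  have "\<exists>v t. t \<le> poly q (val_size u) \<and> eval P [u] (P ! j) v t" for u
    by (rule time_boundE[OF q, of "[u]"]) auto
  with assms(2) show ?thesis unfolding polytime_def by blast
qed

text \<open>Once \<open>j\<close> itself is known to be polynomial it may belong to
  \<open>J\<close>; the equation then unfolds one step of a recursive function.\<close>

lemma run_unfold:
  assumes "\<And>i. i \<in> J \<Longrightarrow> polytime P i" "scoped J 1 (P ! j)"
  shows "run P j u = den P [u] (P ! j)"
proof -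
  from scoped_time_bound[OF assms] obtain q where q: "time_bound P 1 (P ! j) q" by blast
  show ?thesis by (rule time_boundE[OF q, of "[u]"]) (auto dest: run_eqI)
qed

section \<open>Linear recursion\<close>

definition linear_rec :: "nat \<Rightarrow> expr \<Rightarrow> expr \<Rightarrow> expr \<Rightarrow> expr \<Rightarrow> expr" where
  "linear_rec j eC eA eS eB = EIf eC (ELet (ECall j eA) eS) eB"

text \<open>The depth is at most the size of the argument, which shrinks in each call. Each level
  enlarges the result only by an amount depending on the argument; multiplicative growth could make
  it exponential. So all levels work on values of polynomial size.\<close>

lemma polytime_linear_rec:
  assumes J: "\<And>i. i \<in> J \<Longrightarrow> polytime P i"
    and j: "j < length P" "P ! j = linear_rec j eC eA eS eB"
    and scoped: "scoped J 1 eC" "scoped J 1 eA" "scoped J 2 eS" "scoped J 1 eB"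
    and decreasing: "\<And>u. den P [u] eC \<noteq> Num 0 \<Longrightarrow> val_size (den P [u] eA) < val_size u"
    and growth: "\<And>r u. val_size (den P [r, u] eS) \<le> val_size r + poly g (val_size u)"
  shows "polytime P j"
proof -
  from scoped_time_bound[OF J] scoped obtain qC qA qS qB where
    q: "time_bound P 1 eC qC" "time_bound P 1 eA qA" "time_bound P 2 eS qS" "time_bound P 1 eB qB"
    by metis
  \<comment> \<open>At a fixed bound \<open>N\<close> for the sizes of all arguments,
    \<open>qV\<close> bounds the results, \<open>qK\<close> the time of one level, with 3 for the
    conditional, the binding and the call, and \<open>qT\<close> the time of the last level.\<close>
  define qV where "qV = [:0, 1:] * g + qB"
  define qK where "qK = qC + qA + pcompose qS (qV + [:0, 1:]) + [:3:]"
  define qT where "qT = qC + qB + [:1:]"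
  have main: "\<exists>v t. eval P [u] (P ! j) v t \<and> val_size v \<le> val_size u * poly g N + poly qB N \<and>
      t \<le> val_size u * poly qK N + poly qT N" if "val_size u \<le> N" for u N
    using that
  proof (induction "val_size u" arbitrary: u rule: less_induct)
    case less
    have u: "length [u] = 1" "env_size [u] \<le> N" using less.prems by simp_all
    from time_boundE_mono[OF q(1) u] obtain tC where tC:
      "eval P [u] eC (den P [u] eC) tC" "tC \<le> poly qC N" by blast
    show ?case
    proof (cases "den P [u] eC = Num 0")
      case True
      from time_boundE_mono[OF q(4) u] obtain tB where tB:
        "eval P [u] eB (den P [u] eB) tB" "tB \<le> poly qB N" "val_size (den P [u] eB) \<le> poly qB N" .
      have "eval P [u] (P ! j) (den P [u] eB) (tC + tB + 1)"
        unfolding j linear_rec_def using tC(1) tB(1) True by (intro eval_If_false) simp_all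
      then show ?thesis
        using tB tC by (intro exI[of _ "den P [u] eB"] exI[of _ "tC + tB + 1"]) (auto simp: qT_def)
    next
      case False
      from time_boundE_mono[OF q(2) u] obtain tA where tA:
        "eval P [u] eA (den P [u] eA) tA" "tA \<le> poly qA N" by blast
      let ?w = "den P [u] eA"
      have w: "val_size ?w < val_size u" by (rule decreasing[OF False])
      with less obtain v t where vt: "eval P [?w] (P ! j) v t"
        "val_size v \<le> val_size ?w * poly g N + poly qB N"
        "t \<le> val_size ?w * poly qK N + poly qT N"
        by fastforce
      have w': "Suc (val_size ?w) * a \<le> val_size u * a" for a
        using w by (intro mult_le_mono1) simp
      have "val_size ?w * poly g N \<le> N * poly g N"
        using w less.prems by (intro mult_le_mono1) simp
      moreover have "poly qV N = N * poly g N + poly qB N"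
        by (simp add: qV_def)
      ultimately have "val_size v \<le> poly qV N"
        using vt(2) by linarith
      then have "length [v, u] = 2" "env_size [v, u] \<le> poly qV N + N"
        using less.prems by simp_all
      from time_boundE_mono[OF q(3) this] obtain tS where tS:
        "eval P [v, u] eS (den P [v, u] eS) tS" "tS \<le> poly qS (poly qV N + N)" by blast
      let ?t = "tC + ((tA + t + 1) + tS + 1) + 1"
      have "eval P [u] (P ! j) (den P [v, u] eS) ?t"
        unfolding j(2) linear_rec_def using False
        by (intro eval_If_true[OF tC(1)] eval_Let[OF eval_Call[OF tA(1) j(1) vt(1)] tS(1)])
      moreover have "?t \<le> val_size u * poly qK N + poly qT N"
        using tC(2) tA(2) vt(3) tS(2) w'[of "poly qK N"]
        by (simp add: qK_def poly_pcompose algebra_simps)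
      moreover have "val_size (den P [v, u] eS) \<le> val_size u * poly g N + poly qB N"
        using growth[of v u] vt(2) w'[of "poly g N"]
          poly_nat_mono[OF less.prems, of g] by simp
      ultimately show ?thesis by blast
    qed
  qed
  have "\<exists>v t. t \<le> poly ([:0, 1:] * qK + qT) (val_size u) \<and> eval P [u] (P ! j) v t" for u
    using main[of u "val_size u"] by auto
  with j(1) show ?thesis unfolding polytime_def by blast
qed

section \<open>The adaptive greedy algorithm for submodular cover\<close>

text \<open>Each of the \<open>k - m\<close> dropped terms is at least \<open>1 / k\<close>.\<close>

lemma harm_drop:
  assumes "m \<le> k" "0 < k"
  shows "harm m \<le> (harm k :: real) - (real k - real m) / real k"
proof -
  have "(real k - real m) / real k = (\<Sum>i\<in>{m<..k}. 1 / real k)"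
    using assms by (simp add: of_nat_diff)
  also have "\<dots> \<le> (\<Sum>i\<in>{m<..k}. inverse (real i))"
    using assms by (intro sum_mono) (auto simp: field_simps)
  also have "\<dots> = harm k - harm m"
  proof -
    have "{1..k} = {1..m} \<union> {m<..k}" using assms by auto
    then show ?thesis unfolding harm_def by (simp add: sum.union_disjoint disjoint_iff)
  qed
  finally show ?thesis by simp
qed

lemma harm_ge_one: "0 < k \<Longrightarrow> 1 \<le> (harm k :: real)"
  using harm_mono[of 1 k] by (simp add: harm_expand)

text \<open>Stochastic submodular cover, abstracted from formulas: the aim is
  \<open>R b = 0\<close>. Diminishing returns are required for each outcome \<open>v\<close>
  separately, not only on average.\<close>

locale adaptive_cover =
  fixes n :: nat and p c :: "nat \<Rightarrow> real" and R :: "partial_assignment \<Rightarrow> nat"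
  assumes p: "\<And>i. i < n \<Longrightarrow> 0 < p i \<and> p i < 1"
    and c: "\<And>i. i < n \<Longrightarrow> 0 \<le> c i"
    and mono: "\<And>b i v. i < n \<Longrightarrow> b i = None \<Longrightarrow> R (b(i \<mapsto> v)) \<le> R b"
    and submodular: "\<And>b b' i v. i < n \<Longrightarrow> b \<subseteq>\<^sub>m b' \<Longrightarrow> b' i = None \<Longrightarrow>
      real (R b') - real (R (b'(i \<mapsto> v))) \<le> real (R b) - real (R (b(i \<mapsto> v)))"
begin

\<comment> \<open>the simplifier would otherwise unfold updates below eta-expanded arguments of \<open>R\<close>\<close>
declare fun_upd_apply [simp del] fun_upd_same [simp] fun_upd_other [simp]

definition mean :: "nat \<Rightarrow> (bool \<Rightarrow> real) \<Rightarrow> real" where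
  "mean i g = p i * g True + (1 - p i) * g False"

definition gain :: "partial_assignment \<Rightarrow> nat \<Rightarrow> real" where
  "gain b i = mean i (\<lambda>v. real (R b) - real (R (b(i \<mapsto> v))))"

lemma mean_mono: "i < n \<Longrightarrow> (\<And>v. g v \<le> h v) \<Longrightarrow> mean i g \<le> mean i h"
  unfolding mean_def using p[of i] by (intro add_mono mult_left_mono) auto

lemma mean_const [simp]: "mean i (\<lambda>_. a) = a"
  by (simp add: mean_def algebra_simps)

lemma gain_antimono: "i < n \<Longrightarrow> b \<subseteq>\<^sub>m b' \<Longrightarrow> b' i = None \<Longrightarrow> gain b' i \<le> gain b i"
  unfolding gain_def by (intro mean_mono submodular)

text \<open>Conditional expectation of the cost of a tree given the observations \<open>b\<close>, where tests whose
  outcome is already known are free.\<close>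

primrec residual_cost :: "partial_assignment \<Rightarrow> dtree \<Rightarrow> real" where
  "residual_cost b (Leaf v) = 0"
| "residual_cost b (Test i l r) = (case b i of
     Some v \<Rightarrow> if v then residual_cost b r else residual_cost b l
   | None \<Rightarrow> c i + mean i (\<lambda>v. if v then residual_cost (b(i \<mapsto> v)) r else residual_cost (b(i \<mapsto> v)) l))"

text \<open>Weaker than being a strategy: a tree may repeat tests or go on after \<open>R\<close>
  has reached 0. This makes the property stable under further observations.\<close>

primrec covers :: "partial_assignment \<Rightarrow> dtree \<Rightarrow> bool" where
  "covers b (Leaf v) \<longleftrightarrow> R b = 0"
| "covers b (Test i l r) \<longleftrightarrow> i < n \<and> (case b i of
     Some v \<Rightarrow> if v then covers b r else covers b l
   | None \<Rightarrow> covers (b(i \<mapsto> True)) r \<and> covers (b(i \<mapsto> False)) l)"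

primrec cost_before :: "nat \<Rightarrow> partial_assignment \<Rightarrow> dtree \<Rightarrow> real" where
  "cost_before j b (Leaf v) = 0"
| "cost_before j b (Test i l r) = (if i = j then 0 else case b i of
     Some v \<Rightarrow> if v then cost_before j b r else cost_before j b l
   | None \<Rightarrow> c i + mean i (\<lambda>v. if v then cost_before j (b(i \<mapsto> v)) r else cost_before j (b(i \<mapsto> v)) l))"

primrec prob_tested :: "nat \<Rightarrow> partial_assignment \<Rightarrow> dtree \<Rightarrow> real" where
  "prob_tested j b (Leaf v) = 0"
| "prob_tested j b (Test i l r) = (if i = j then 1 else case b i of
     Some v \<Rightarrow> if v then prob_tested j b r else prob_tested j b l
   | None \<Rightarrow> mean i (\<lambda>v. if v then prob_tested j (b(i \<mapsto> v)) r else prob_tested j (b(i \<mapsto> v)) l))"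

lemma mean_nonneg: "i < n \<Longrightarrow> 0 \<le> g True \<Longrightarrow> 0 \<le> g False \<Longrightarrow> 0 \<le> mean i g"
  unfolding mean_def using p[of i] by simp

lemma prob_tested_nonneg: "covers b \<pi> \<Longrightarrow> 0 \<le> prob_tested j b \<pi>"
  by (induction \<pi> arbitrary: b) (auto split: option.splits if_splits intro!: mean_nonneg)

lemma residual_cost_nonneg: "covers b \<pi> \<Longrightarrow> 0 \<le> residual_cost b \<pi>"
  by (induction \<pi> arbitrary: b) (auto split: option.splits if_splits intro!: mean_nonneg add_nonneg_nonneg c)

lemma covers_observe: "covers b \<pi> \<Longrightarrow> j < n \<Longrightarrow> b j = None \<Longrightarrow> covers (b(j \<mapsto> v)) \<pi>"
proof (induction \<pi> arbitrary: b)
  case (Leaf a)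
  then show ?case using mono[of j b v] by simp
next
  case (Test i l r)
  show ?case
  proof (cases "i = j")
    case True
    with Test.prems show ?thesis by (cases v) auto
  next
    case False
    with Test show ?thesis
      by (auto split: option.splits simp: fun_upd_twist[of j i])
  qed
qed

text \<open>Revealing the outcome of \<open>j\<close> in advance makes its test free and leaves the
  rest of the run unchanged; \<open>c j\<close> is saved whenever \<open>j\<close> is
  tested.\<close>

lemma residual_cost_observe:
  "covers b \<pi> \<Longrightarrow> j < n \<Longrightarrow> b j = None \<Longrightarrow>
   residual_cost b \<pi> = prob_tested j b \<pi> * c j + mean j (\<lambda>v. residual_cost (b(j \<mapsto> v)) \<pi>)"
proof (induction \<pi> arbitrary: b)
  case (Test i l r)
  consider "i = j" | v where "i \<noteq> j" "b i = Some v" | "i \<noteq> j" "b i = None" by blast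
  then show ?case
  proof cases
    case 1
    with Test.prems show ?thesis by (simp add: mean_def)
  next
    case 2
    with Test show ?thesis by (cases v) auto
  next
    case 3
    then have twist: "b(i \<mapsto> x, j \<mapsto> y) = b(j \<mapsto> y, i \<mapsto> x)" for x y
      by (simp add: fun_upd_twist)
    from 3 Test have IH:
      "residual_cost (b(i \<mapsto> True)) r = prob_tested j (b(i \<mapsto> True)) r * c j
        + mean j (\<lambda>v. residual_cost (b(j \<mapsto> v, i \<mapsto> True)) r)"
      "residual_cost (b(i \<mapsto> False)) l = prob_tested j (b(i \<mapsto> False)) l * c j
        + mean j (\<lambda>v. residual_cost (b(j \<mapsto> v, i \<mapsto> False)) l)"
      by (auto simp flip: twist)
    from 3 show ?thesis by (simp add: IH mean_def algebra_simps)
  qed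
qed simp

text \<open>Up to the test of \<open>j\<close> the run does not depend on the outcome of
  \<open>j\<close>, and later tests have nonnegative cost.\<close>

lemma cost_before_le_residual_cost:
  "covers b \<pi> \<Longrightarrow> j < n \<Longrightarrow> b j = None \<Longrightarrow> cost_before j b \<pi> \<le> residual_cost (b(j \<mapsto> v)) \<pi>"
proof (induction \<pi> arbitrary: b)
  case (Test i l r)
  consider "i = j" | v where "i \<noteq> j" "b i = Some v" | "i \<noteq> j" "b i = None" by blast
  then show ?case
  proof cases
    case 1
    have "covers (b(j \<mapsto> v)) (Test i l r)" using Test.prems by (intro covers_observe) auto
    from residual_cost_nonneg[OF this] 1 show ?thesis by simp
  next
    case (2 v)
    with Test show ?thesis by (cases v) auto
  next
    case 3
    then have twist: "b(j \<mapsto> y, i \<mapsto> x) = b(i \<mapsto> x, j \<mapsto> y)" for x y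
      by (simp add: fun_upd_twist)
    from 3 Test show ?thesis by (auto simp: twist intro!: mean_mono)
  qed
qed simp

text \<open>The tests that \<open>\<pi>\<close> makes before \<open>j\<close> are chosen without knowledge of \<open>x\<^sub>j\<close>, and by
  submodularity none of them is more cost-effective than \<open>j\<close>.\<close>

lemma greedy_choice_bound:
  assumes j: "j < n" "b j = None"
    and choice: "\<And>i. i < n \<Longrightarrow> b i = None \<Longrightarrow> c j * gain b i \<le> c i * gain b j"
  shows "covers b' \<pi> \<Longrightarrow> b \<subseteq>\<^sub>m b' \<Longrightarrow> b' j = None \<Longrightarrow> R b' \<le> R b \<Longrightarrow>
    c j * ((1 - prob_tested j b' \<pi>) * R b) \<le> c j * (real (R b) - R b') + gain b j * cost_before j b' \<pi>"
\<comment> \<open>\<open>b\<close> stays the state in which \<open>j\<close> was chosen, while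
  \<open>b'\<close> moves down the tree; \<open>R b - R b'\<close> is the decrease achieved on the
  way. At a leaf \<open>R b' = 0\<close>, and at a test of \<open>j\<close> the left-hand side
  vanishes.\<close>
proof (induction \<pi> arbitrary: b')
  case (Leaf v)
  then show ?case by simp
next
  case (Test i l r)
  then have i: "i < n" by simp
  consider "i = j" | v where "i \<noteq> j" "b' i = Some v" | "i \<noteq> j" "b' i = None" by blast
  then show ?case
  proof cases
    case 1
    with Test.prems c[OF j(1)] show ?thesis by simp
  next
    case (2 v)
    with Test show ?thesis by (cases v) auto
  next
    case 3
    define s where "s v = (if v then r else l)" for v
    have bi: "b i = None" using 3 Test.prems(2) by (auto simp: map_le_def dom_def)
    have le: "b \<subseteq>\<^sub>m b'(i \<mapsto> v)" for v
      using Test.prems(2) bi by (auto simp: map_le_def dom_def fun_upd_apply)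
    have IH: "c j * ((1 - prob_tested j (b'(i \<mapsto> v)) (s v)) * R b)
        \<le> c j * (real (R b) - R (b'(i \<mapsto> v))) + gain b j * cost_before j (b'(i \<mapsto> v)) (s v)" for v
    proof -
      have "R (b'(i \<mapsto> v)) \<le> R b" using mono[of i b' v] i 3 Test.prems by simp
      with Test 3 le[of v] show ?thesis by (cases v) (simp_all add: s_def)
    qed
    have eq: "prob_tested j b' (Test i l r) = mean i (\<lambda>v. prob_tested j (b'(i \<mapsto> v)) (s v))"
      "cost_before j b' (Test i l r) = c i + mean i (\<lambda>v. cost_before j (b'(i \<mapsto> v)) (s v))"
      using 3 by (simp_all add: s_def mean_def)
    \<comment> \<open>By submodularity the gain of \<open>i\<close> has not grown since
      \<open>b\<close>, where \<open>j\<close> was at least as good a choice.\<close>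
    have "c j * gain b' i \<le> c j * gain b i"
      using gain_antimono[OF i Test.prems(2) 3(2)] c[OF j(1)] by (rule mult_left_mono)
    also have "\<dots> \<le> c i * gain b j" by (rule choice[OF i bi])
    finally have *: "c j * gain b' i \<le> c i * gain b j" .
    have "c j * ((1 - prob_tested j b' (Test i l r)) * R b)
        = mean i (\<lambda>v. c j * ((1 - prob_tested j (b'(i \<mapsto> v)) (s v)) * R b))"
      unfolding eq by (simp add: mean_def algebra_simps)
    also have "\<dots> \<le> mean i (\<lambda>v. c j * (real (R b) - R (b'(i \<mapsto> v)))
        + gain b j * cost_before j (b'(i \<mapsto> v)) (s v))"
      by (rule mean_mono[OF i IH])
    also have "\<dots> = c j * (real (R b) - R b') + c j * gain b' i
        + gain b j * mean i (\<lambda>v. cost_before j (b'(i \<mapsto> v)) (s v))"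
      by (simp add: gain_def mean_def algebra_simps)
    also have "\<dots> \<le> c j * (real (R b) - R b') + gain b j * cost_before j b' (Test i l r)"
      using * unfolding eq by (simp add: algebra_simps)
    finally show ?thesis .
  qed
qed

text \<open>The ratios are compared by cross-multiplication, which needs no exception for gain
  0.\<close>

primrec greedy :: "partial_assignment \<Rightarrow> dtree \<Rightarrow> bool" where
  "greedy b (Leaf v) \<longleftrightarrow> True"
| "greedy b (Test j l r) \<longleftrightarrow> j < n \<and> b j = None \<and> 0 < R b \<and>
     (\<forall>i<n. b i = None \<longrightarrow> c j * gain b i \<le> c i * gain b j) \<and>
     greedy (b(j \<mapsto> False)) l \<and> greedy (b(j \<mapsto> True)) r"

text \<open>The comparison tree \<open>\<pi>\<close> stays the same all the way down the greedy
  tree: its tests already answered become free, so \<open>covers\<close> is all that has to be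
  preserved.\<close>

theorem greedy_residual_cost:
  "greedy b T \<Longrightarrow> covers b \<pi> \<Longrightarrow> residual_cost b T \<le> harm (R b) * residual_cost b \<pi>"
proof (induction T arbitrary: b)
  case (Leaf v)
  then show ?case by (simp add: residual_cost_nonneg harm_nonneg)
next
  case (Test j l r)
  then have j: "j < n" "b j = None" and pos: "0 < R b"
    and choice: "\<And>i. i < n \<Longrightarrow> b i = None \<Longrightarrow> c j * gain b i \<le> c i * gain b j"
    by auto
  define W where "W v = residual_cost (b(j \<mapsto> v)) \<pi>" for v
  define u where "u = cost_before j b \<pi>"
  define q where "q = prob_tested j b \<pi>"
  define \<Delta> where "\<Delta> v = real (R b) - real (R (b(j \<mapsto> v)))" for v
  define H where "H = (harm (R b) :: real)"
  have \<Delta>0: "0 \<le> \<Delta> v" for v using mono[of j b] j by (simp add: \<Delta>_def)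
  have uW: "u \<le> W v" for v
    unfolding u_def W_def using Test.prems j by (intro cost_before_le_residual_cost)
  have W0: "0 \<le> W v" for v
    unfolding W_def using Test.prems j by (intro residual_cost_nonneg covers_observe)
  have sub: "(if v then residual_cost (b(j \<mapsto> v)) r else residual_cost (b(j \<mapsto> v)) l)
      \<le> H * W v - (\<Delta> v * u) / R b" for v
  proof -
    have "(if v then residual_cost (b(j \<mapsto> v)) r else residual_cost (b(j \<mapsto> v)) l)
        \<le> harm (R (b(j \<mapsto> v))) * W v"
      using Test covers_observe[OF Test.prems(2) j, of v] by (cases v) (simp_all add: W_def)
    \<comment> \<open>The drop of the harmonic number is released here; next, its multiple of
      \<open>W v\<close> is weakened to the same multiple of \<open>u\<close>, which does not depend
      on the outcome.\<close>
    also have "\<dots> \<le> (H - \<Delta> v / R b) * W v"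
      unfolding H_def \<Delta>_def using mono[of j b] j pos W0 by (intro mult_right_mono harm_drop)
    also have "\<dots> \<le> H * W v - \<Delta> v / R b * u"
      using uW \<Delta>0 by (auto simp: left_diff_distrib intro!: mult_left_mono divide_right_mono)
    finally show ?thesis by simp
  qed
  have "residual_cost b (Test j l r) \<le> c j + mean j (\<lambda>v. H * W v - (\<Delta> v * u) / R b)"
    using mean_mono[OF j(1) sub] j by simp
  also have "\<dots> = c j + H * mean j W - gain b j * u / R b"
    by (simp add: mean_def gain_def \<Delta>_def[symmetric] algebra_simps
        add_divide_distrib diff_divide_distrib)
  also have "mean j W = residual_cost b \<pi> - q * c j"
    using residual_cost_observe[OF Test.prems(2) j] by (simp add: W_def[abs_def] q_def)
  also have "c j + H * (residual_cost b \<pi> - q * c j) - gain b j * u / R b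
      \<le> c j + H * (residual_cost b \<pi> - q * c j) - c j * (1 - q)"
  proof -
    have "c j * ((1 - q) * R b) \<le> gain b j * u"
      using greedy_choice_bound[OF j choice, of b \<pi>] Test.prems j by (simp add: q_def u_def)
    then have "c j * (1 - q) \<le> gain b j * u / R b"
      using pos by (simp add: field_simps)
    then show ?thesis by simp
  qed
  also have "\<dots> = H * residual_cost b \<pi> - (H - 1) * (q * c j)"
    by (simp add: algebra_simps)
  also have "\<dots> \<le> H * residual_cost b \<pi>"
    using harm_ge_one[OF pos] prob_tested_nonneg[OF Test.prems(2)] c[OF j(1)]
    by (simp add: H_def q_def)
  finally show ?case by (simp add: H_def)
qed

text \<open>Conditioning on coordinate \<open>i\<close>. Overwriting \<open>x i\<close> in a full
  sample avoids a separate distribution on the other coordinates in the statement.\<close>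

lemma expectation_input_dist_split:
  assumes "i < n"
  shows "measure_pmf.expectation (input_dist n p) g =
    mean i (\<lambda>v. measure_pmf.expectation (input_dist n p) (\<lambda>x. g (x(i := v))))"
proof -
  let ?D = "Pi_pmf ({..<n} - {i}) False (\<lambda>i. bernoulli_pmf (p i))"
  have D: "input_dist n p = map_pmf (\<lambda>(x, f). f(i := x)) (pair_pmf (bernoulli_pmf (p i)) ?D)"
    unfolding input_dist_def using assms
    by (subst Pi_pmf_insert[symmetric]) (auto simp: insert_absorb)
  have fin: "finite (set_pmf ?D)"
    by (rule finite_subset[OF set_Pi_pmf_subset']) (auto intro!: finite_PiE_dflt)
  have E: "measure_pmf.expectation (input_dist n p) h =
      mean i (\<lambda>v. measure_pmf.expectation ?D (\<lambda>f. h (f(i := v))))" for h :: "assignment \<Rightarrow> real"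
  proof -
    have "input_dist n p =
        bind_pmf (bernoulli_pmf (p i)) (\<lambda>v. map_pmf (\<lambda>f. f(i := v)) ?D)"
      unfolding D pair_pmf_def map_bind_pmf by (simp add: map_pmf_def bind_assoc_pmf bind_return_pmf)
    then have "measure_pmf.expectation (input_dist n p) h = (\<Sum>v\<in>UNIV.
        pmf (bernoulli_pmf (p i)) v *\<^sub>R measure_pmf.expectation (map_pmf (\<lambda>f. f(i := v)) ?D) h)"
      using fin by (simp only:) (rule pmf_expectation_bind, auto)
    then show ?thesis
      using p[OF assms] by (simp add: UNIV_bool mean_def)
  qed
  show ?thesis
    \<comment> \<open>The right-hand side is split as well; the outcome of \<open>i\<close> sampled
      there is overwritten and has no effect.\<close>
    unfolding E[of g] E[of "\<lambda>x. g (x(i := v))" for v] by simp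
qed

text \<open>The sample is overwritten by \<open>b\<close> on observed coordinates, so that the
  induction applies to the subtrees of a strategy.\<close>

lemma expected_cost_residual_cost:
  assumes "strategy_from n f b T"
  shows "measure_pmf.expectation (input_dist n p)
      (\<lambda>x. testing_cost c T (\<lambda>i. case b i of Some v \<Rightarrow> v | None \<Rightarrow> x i)) = residual_cost b T"
  using assms
proof (induction T arbitrary: b)
  case (Test i l r)
  then have i: "i < n" "b i = None" by auto
  have upd: "(\<lambda>k. case b k of Some v \<Rightarrow> v | None \<Rightarrow> (x(i := w)) k)
      = (\<lambda>k. case (b(i \<mapsto> w)) k of Some v \<Rightarrow> v | None \<Rightarrow> x k)" for x w
    using i by (auto simp: fun_eq_iff fun_upd_apply split: option.splits)
  have int: "integrable (measure_pmf (input_dist n p)) h" for h :: "assignment \<Rightarrow> real"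
    unfolding input_dist_def
    by (intro integrable_measure_pmf_finite finite_subset[OF set_Pi_pmf_subset'])
      (auto intro!: finite_PiE_dflt)
  show ?case
    by (subst expectation_input_dist_split[OF i(1)])
      (use i Test int in \<open>simp add: upd mean_def algebra_simps\<close>)
qed simp

end

section \<open>The greedy algorithm as a program\<close>

abbreviation (input) "Hd e \<equiv> EOp1 First e"
abbreviation (input) "Tl e \<equiv> EOp1 Second e"
abbreviation (input) "Pr e e' \<equiv> EOp2 MkCell e e'"
abbreviation (input) "Eq e e' \<equiv> EOp2 Mul (EOp2 Leq e e') (EOp2 Leq e' e)"
abbreviation (input) "FunArg \<equiv> EVar 0"
abbreviation (input) "Rec \<equiv> EVar 0"
abbreviation (input) "RecArg \<equiv> EVar 1"

text \<open>
  Function numbers are positions in \<open>greedy_program\<close>. The arguments of the functions, with nested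
  pairs standing for cells, are: \<open>((formulas, probs, costs), b)\<close> for \<open>main\<close>,
  \<open>((probs, costs), i, formulas, b)\<close> for \<open>best\<close>, where the two lists start at variable \<open>i\<close>,
  \<open>((prob, cost), i, formulas, b)\<close> for \<open>score\<close>, \<open>(formulas, b)\<close> for \<open>potential\<close>,
  \<open>(formula, w, b)\<close> for \<open>live\<close>, \<open>(literals, clause, w, b)\<close> for \<open>dead\<close>, \<open>(literals, l)\<close> for
  \<open>negated\<close>, \<open>(b, i)\<close> for \<open>lookup\<close> and \<open>(b, i, v)\<close> for \<open>update\<close>. In the step of a linear
  recursion, \<open>Rec\<close> is the result of the recursive call and \<open>RecArg\<close> the argument.
\<close>

definition main_body :: expr where
  "main_body = (let formulas = Hd (Hd FunArg); bs = Tl FunArg in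
     EIf (ECall 4 (Pr (Hd formulas) (Pr (ENum 1) bs)))
       (EIf (ECall 4 (Pr (Tl formulas) (Pr (ENum 0) bs)))
         (Pr (ENum 0) (Hd (ECall 1 (Pr (Tl (Hd FunArg)) (Pr (ENum 0) (Pr formulas bs))))))
         (Pr (ENum 1) (ENum 0)))
       (Pr (ENum 1) (ENum 1)))"

text \<open>A right fold whose result is \<open>Num 0\<close> or an index with its scaled cost and
  gain. The cell checks on all parts make the argument shrink, whatever its form, although the index
  grows.\<close>

definition best_body :: expr where
  "best_body = linear_rec 1
     (EOp2 Mul (EOp1 IsCell (Hd (Hd FunArg))) (EOp2 Mul (EOp1 IsCell (Tl (Hd FunArg))) (EOp1 IsCell (Tl FunArg))))
     (Pr (Pr (Tl (Hd (Hd FunArg))) (Tl (Tl (Hd FunArg)))) (Pr (EOp2 Add (Hd (Tl FunArg)) (ENum 1)) (Tl (Tl FunArg))))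
     (ELet (ECall 2 (Pr (Pr (Hd (Hd (Hd RecArg))) (Hd (Tl (Hd RecArg)))) (Tl RecArg)))
       (let score = EVar 0; rest = EVar 1; arg = EVar 2 in
        EIf (EOp2 Leq (Tl score) (ENum 0)) rest
          (EIf (EOp1 IsCell rest)
            (EIf (EOp2 Leq (EOp2 Mul (Hd score) (Tl (Tl rest))) (EOp2 Mul (Hd (Tl rest)) (Tl score)))
              (Pr (Hd (Tl arg)) score) rest)
            (Pr (Hd (Tl arg)) score))))
     (ENum 0)"

text \<open>Clearing both denominators keeps cost and gain natural numbers without changing their
  ratio. A tested variable gets gain 0.\<close>

definition score_body :: expr where
  "score_body = (let prob = Hd (Hd FunArg); cost = Tl (Hd FunArg); i = Hd (Tl FunArg);
       formulas = Hd (Tl (Tl FunArg)); bs = Tl (Tl (Tl FunArg));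
       drop = (\<lambda>k. EOp2 Sub (ECall 3 (Pr formulas bs))
                 (ECall 3 (Pr formulas (ECall 8 (Pr bs (Pr i (ENum k)))))))
     in Pr (EOp2 Mul (Hd cost) (Tl prob))
       (EIf (ECall 7 (Pr bs i)) (ENum 0)
         (EOp2 Mul (Tl cost) (EOp2 Add (EOp2 Mul (Hd prob) (drop 2))
            (EOp2 Mul (EOp2 Sub (Tl prob) (Hd prob)) (drop 1))))))"

definition potential_body :: expr where
  "potential_body = EOp2 Mul (ECall 4 (Pr (Hd (Hd FunArg)) (Pr (ENum 1) (Tl FunArg))))
     (ECall 4 (Pr (Tl (Hd FunArg)) (Pr (ENum 0) (Tl FunArg))))"

text \<open>The clause is passed twice, once to be scanned and once to be searched for complementary
  literals.\<close>

definition live_body :: expr where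
  "live_body = linear_rec 4 (EOp1 IsCell (Hd FunArg)) (Pr (Tl (Hd FunArg)) (Tl FunArg))
     (EOp2 Add Rec (EIf (ECall 5 (Pr (Hd (Hd RecArg)) (Pr (Hd (Hd RecArg)) (Tl RecArg)))) (ENum 0) (ENum 1)))
     (ENum 0)"

text \<open>One plus the truth value of \<open>Tl l = w\<close> is the code of the entry
  \<open>Some (snd l = w)\<close>.\<close>

definition dead_body :: expr where
  "dead_body = linear_rec 5 (EOp1 IsCell (Hd FunArg)) (Pr (Tl (Hd FunArg)) (Tl FunArg))
     (let l = Hd (Hd RecArg); clause = Hd (Tl RecArg); w = Hd (Tl (Tl RecArg)); bs = Tl (Tl (Tl RecArg)) in
      EIf (Eq (ECall 7 (Pr bs (Hd l))) (EOp2 Add (ENum 1) (Eq (Tl l) w))) (ENum 1)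
        (EIf (ECall 6 (Pr clause l)) (ENum 1) Rec))
     (ENum 0)"

definition negated_body :: expr where
  "negated_body = linear_rec 6 (EOp1 IsCell (Hd FunArg)) (Pr (Tl (Hd FunArg)) (Tl FunArg))
     (let l = Hd (Hd RecArg) in
      EIf (Eq (Hd l) (Hd (Tl RecArg))) (EIf (Eq (Tl l) (Tl (Tl RecArg))) Rec (ENum 1)) Rec)
     (ENum 0)"

text \<open>The recursive call is made at every index and its result dropped at index 0; truncated
  subtraction keeps the index at 0 from there on.\<close>

definition lookup_body :: expr where
  "lookup_body = linear_rec 7 (EOp1 IsCell (Hd FunArg)) (Pr (Tl (Hd FunArg)) (EOp2 Sub (Tl FunArg) (ENum 1)))
     (EIf (EOp2 Leq (Tl RecArg) (ENum 0)) (Hd (Hd RecArg)) Rec)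
     (ENum 0)"

definition update_body :: expr where
  "update_body = linear_rec 8 (EOp2 Mul (EOp1 IsCell (Hd FunArg)) (EOp1 IsCell (Tl FunArg)))
     (Pr (Tl (Hd FunArg)) (Pr (EOp2 Sub (Hd (Tl FunArg)) (ENum 1)) (Tl (Tl FunArg))))
     (EIf (EOp2 Leq (Hd (Tl RecArg)) (ENum 0)) (Pr (Tl (Tl RecArg)) (Tl (Hd RecArg))) (Pr (Hd (Hd RecArg)) Rec))
     (ENum 0)"

definition greedy_program :: program where
  "greedy_program = [main_body, best_body, score_body, potential_body, live_body, dead_body,
     negated_body, lookup_body, update_body]"

lemma length_greedy_program: "length greedy_program = 9"
  by (simp add: greedy_program_def)

lemma greedy_program_nth:
  "greedy_program ! 0 = main_body" "greedy_program ! 1 = best_body"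
  "greedy_program ! 2 = score_body" "greedy_program ! 3 = potential_body"
  "greedy_program ! 4 = live_body" "greedy_program ! 5 = dead_body"
  "greedy_program ! 6 = negated_body" "greedy_program ! 7 = lookup_body"
  "greedy_program ! 8 = update_body"
  by (simp_all add: greedy_program_def)

section \<open>Polynomial running time of the nine functions\<close>

lemma val_size_Num_diff: "val_size (Num (num v - k)) \<le> val_size v"
proof -
  have "val_size (Num (num v - k)) \<le> val_size (Num (num v))"
    by (simp add: floor_log_mono_nat)
  with val_size_Num_num[of v] show ?thesis by linarith
qed

lemma val_size_Num_Suc: "val_size (Num (Suc (num v))) \<le> val_size v + 1"
proof -
  have "Suc (num v) < 2 ^ (val_size (Num (num v)) + 1)"
    using less_two_power_val_size[of "num v"] by (simp del: val_size.simps)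
  from val_size_Num_le[OF this] val_size_Num_num[of v] show ?thesis by linarith
qed

lemma list_rec_decreasing:
  assumes "den P [u] (EOp1 IsCell (Hd FunArg)) \<noteq> Num 0"
  shows "val_size (den P [u] (Pr (Tl (Hd FunArg)) (Tl FunArg))) < val_size u"
proof -
  from assms obtain h t v where "u = Cell (Cell h t) v"
    by (cases u; cases "apply1 First u") auto
  then show ?thesis by simp
qed

lemma polytime_update: "polytime greedy_program 8"
\<comment> \<open>The step may build a cell from two parts of the argument, hence twice its size
  plus 1.\<close>
proof (rule polytime_linear_rec[where J = "{}" and g = "[:1, 2:]",
      OF _ _ greedy_program_nth(9)[unfolded update_body_def]])
  fix u :: val
  assume *: "den greedy_program [u] (EOp2 Mul (EOp1 IsCell (Hd FunArg)) (EOp1 IsCell (Tl FunArg))) \<noteq> Num 0"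
  then obtain h t i v where u: "u = Cell (Cell h t) (Cell i v)"
    by (cases u; cases "apply1 First u"; cases "apply1 Second u") auto
  then show "val_size (den greedy_program [u]
      (Pr (Tl (Hd FunArg)) (Pr (EOp2 Sub (Hd (Tl FunArg)) (ENum 1)) (Tl (Tl FunArg))))) < val_size u"
    using val_size_Num_diff[of i 1] by simp
next
  fix r u :: val
  have "val_size (apply1 First (apply1 First u)) \<le> val_size u"
    "val_size (apply1 Second (apply1 Second u)) \<le> val_size u"
    "val_size (apply1 Second (apply1 First u)) \<le> val_size u"
    using val_size_apply1 order_trans by blast+
  then show "val_size (den greedy_program [r, u]
      (EIf (EOp2 Leq (Hd (Tl RecArg)) (ENum 0)) (Pr (Tl (Tl RecArg)) (Tl (Hd RecArg))) (Pr (Hd (Hd RecArg)) Rec)))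
      \<le> val_size r + poly [:1, 2:] (val_size u)"
    by simp
qed (simp_all add: length_greedy_program)

lemma polytime_lookup: "polytime greedy_program 7"
proof (rule polytime_linear_rec[where J = "{}" and g = "[:0, 1:]",
      OF _ _ greedy_program_nth(8)[unfolded lookup_body_def]])
  fix u :: val
  assume *: "den greedy_program [u] (EOp1 IsCell (Hd FunArg)) \<noteq> Num 0"
  then obtain h t i where u: "u = Cell (Cell h t) i"
    by (cases u; cases "apply1 First u") auto
  then show "val_size (den greedy_program [u] (Pr (Tl (Hd FunArg)) (EOp2 Sub (Tl FunArg) (ENum 1)))) < val_size u"
    using val_size_Num_diff[of i 1] by simp
next
  fix r u :: val
  have "val_size (apply1 First (apply1 First u)) \<le> val_size u"
    using val_size_apply1 order_trans by blast
  then show "val_size (den greedy_program [r, u] (EIf (EOp2 Leq (Tl RecArg) (ENum 0)) (Hd (Hd RecArg)) Rec))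
      \<le> val_size r + poly [:0, 1:] (val_size u)"
    by simp
qed (simp_all add: length_greedy_program)

lemma polytime_negated: "polytime greedy_program 6"
  by (rule polytime_linear_rec[where J = "{}" and g = "[:1:]",
        OF _ _ greedy_program_nth(7)[unfolded negated_body_def Let_def] _ _ _ _ list_rec_decreasing])
    (auto simp: length_greedy_program floor_log_zero)

lemma polytime_dead: "polytime greedy_program 5"
  by (rule polytime_linear_rec[where J = "{6, 7}" and g = "[:1:]",
        OF _ _ greedy_program_nth(6)[unfolded dead_body_def Let_def] _ _ _ _ list_rec_decreasing])
    (auto simp: length_greedy_program floor_log_zero polytime_lookup polytime_negated)

lemma polytime_live: "polytime greedy_program 4"
proof (rule polytime_linear_rec[where J = "{5}" and g = "[:2:]",
      OF _ _ greedy_program_nth(5)[unfolded live_body_def] _ _ _ _ list_rec_decreasing])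
  fix r u :: val
  have "val_size (apply2 Add r (Num 0)) \<le> val_size r + 2" "val_size (apply2 Add r (Num 1)) \<le> val_size r + 2"
    using val_size_apply2[of Add r "Num 0"] val_size_apply2[of Add r "Num 1"]
    by (simp_all add: floor_log_zero)
  then show "val_size (den greedy_program [r, u]
      (EOp2 Add Rec (EIf (ECall 5 (Pr (Hd (Hd RecArg)) (Pr (Hd (Hd RecArg)) (Tl RecArg)))) (ENum 0) (ENum 1))))
      \<le> val_size r + poly [:2:] (val_size u)"
    by simp
qed (simp_all add: length_greedy_program polytime_dead)

lemma polytime_potential: "polytime greedy_program 3"
  by (rule polytime_nonrec[where J = "{4}"])
    (simp_all only: length_greedy_program greedy_program_nth potential_body_def, simp_all add: polytime_live)

lemma polytime_score: "polytime greedy_program 2"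
  by (rule polytime_nonrec[where J = "{3, 7, 8}"])
    (simp_all only: length_greedy_program greedy_program_nth score_body_def Let_def,
      auto simp: polytime_potential polytime_lookup polytime_update)

lemma polytime_best: "polytime greedy_program 1"
proof -
  obtain q :: "nat poly" where q: "\<And>u. val_size (run greedy_program 2 u) \<le> poly q (val_size u)"
    using polytime_score by (rule polytimeE) blast
  show ?thesis
  \<comment> \<open>The score is computed from three parts of the argument joined by two cells,
    whence \<open>[:2, 3:]\<close>; \<open>[:1, 1:]\<close> pays for the index and its cell.\<close>
  proof (rule polytime_linear_rec[where J = "{2}" and g = "pcompose q [:2, 3:] + [:1, 1:]",
      OF _ _ greedy_program_nth(2)[unfolded best_body_def Let_def]])
    fix u :: val
    assume *: "den greedy_program [u] (EOp2 Mul (EOp1 IsCell (Hd (Hd FunArg)))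
      (EOp2 Mul (EOp1 IsCell (Tl (Hd FunArg))) (EOp1 IsCell (Tl FunArg)))) \<noteq> Num 0"
    then obtain a v where u: "u = Cell a v" by (cases u) auto
    with * obtain a1 a2 i w where "a = Cell a1 a2" "v = Cell i w"
      by (cases a; cases v) auto
    with * u obtain h t h' t' where u: "u = Cell (Cell (Cell h t) (Cell h' t')) (Cell i w)"
      by (cases a1; cases a2) auto
    then show "val_size (den greedy_program [u] (Pr (Pr (Tl (Hd (Hd FunArg))) (Tl (Tl (Hd FunArg))))
        (Pr (EOp2 Add (Hd (Tl FunArg)) (ENum 1)) (Tl (Tl FunArg))))) < val_size u"
      using val_size_Num_Suc[of i] by simp
  next
    fix r u :: val
    let ?w = "Cell (Cell (apply1 First (apply1 First (apply1 First u)))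
      (apply1 First (apply1 Second (apply1 First u)))) (apply1 Second u)"
    have le: "val_size (apply1 First (apply1 First (apply1 First u))) \<le> val_size u"
      "val_size (apply1 First (apply1 Second (apply1 First u))) \<le> val_size u"
      "val_size (apply1 Second u) \<le> val_size u" "val_size (apply1 First (apply1 Second u)) \<le> val_size u"
      using val_size_apply1 order_trans by meson+
    have "val_size (run greedy_program 2 ?w) \<le> poly q (val_size ?w)" by (rule q)
    also have "\<dots> \<le> poly q (2 + val_size u * 3)"
      using le by (intro poly_nat_mono) simp
    finally have "val_size (run greedy_program 2 ?w) \<le> poly q (2 + val_size u * 3)" .
    with le(4) show "val_size (den greedy_program [r, u]
       (ELet (ECall 2 (Pr (Pr (Hd (Hd (Hd RecArg))) (Hd (Tl (Hd RecArg)))) (Tl RecArg)))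
        (EIf (EOp2 Leq (Tl (EVar 0)) (ENum 0)) (EVar 1)
          (EIf (EOp1 IsCell (EVar 1))
            (EIf (EOp2 Leq (EOp2 Mul (Hd (EVar 0)) (Tl (Tl (EVar 1))))
                   (EOp2 Mul (Hd (Tl (EVar 1))) (Tl (EVar 0))))
              (Pr (Hd (Tl (EVar 2))) (EVar 0)) (EVar 1))
            (Pr (Hd (Tl (EVar 2))) (EVar 0))))))
       \<le> val_size r + poly (pcompose q [:2, 3:] + [:1, 1:]) (val_size u)"
      by (simp add: poly_pcompose)
  qed (simp_all add: length_greedy_program polytime_score)
qed

lemma polytime_main: "polytime greedy_program 0"
  by (rule polytime_nonrec[where J = "{1, 4}"])
    (simp_all only: length_greedy_program greedy_program_nth main_body_def Let_def,
      auto simp: polytime_best polytime_live simp del: One_nat_def)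

lemmas polytime_greedy_program = polytime_main polytime_best polytime_score polytime_potential
  polytime_live polytime_dead polytime_negated polytime_lookup polytime_update

section \<open>Values of the functions on encoded arguments\<close>

lemma run_greedy_program:
  assumes "j < 9"
  shows "run greedy_program j u = den greedy_program [u] (greedy_program ! j)"
proof (rule run_unfold)
  fix i :: nat assume "i \<in> {..<9}"
  then have "i \<in> {0, 1, 2, 3, 4, 5, 6, 7, 8}" by auto
  then show "polytime greedy_program i" using polytime_greedy_program by blast
next
  from assms have "j \<in> {0, 1, 2, 3, 4, 5, 6, 7, 8}" by auto
  then show "scoped {..<9} 1 (greedy_program ! j)"
    by (elim insertE emptyE; simp only: greedy_program_nth main_body_def best_body_def
      score_body_def potential_body_def live_body_def dead_body_def negated_body_def lookup_body_def
      update_body_def linear_rec_def Let_def; simp)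
qed

lemmas run_main = run_greedy_program[of 0, unfolded greedy_program_nth main_body_def Let_def
  linear_rec_def, simplified]
lemmas run_best = run_greedy_program[of 1, unfolded greedy_program_nth best_body_def Let_def
  linear_rec_def, simplified]
lemmas run_score = run_greedy_program[of 2, unfolded greedy_program_nth score_body_def Let_def
  linear_rec_def, simplified]
lemmas run_potential = run_greedy_program[of 3, unfolded greedy_program_nth potential_body_def Let_def
  linear_rec_def, simplified]
lemmas run_live = run_greedy_program[of 4, unfolded greedy_program_nth live_body_def Let_def
  linear_rec_def, simplified]
lemmas run_dead = run_greedy_program[of 5, unfolded greedy_program_nth dead_body_def Let_def
  linear_rec_def, simplified]
lemmas run_negated = run_greedy_program[of 6, unfolded greedy_program_nth negated_body_def Let_def
  linear_rec_def, simplified]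
lemmas run_lookup = run_greedy_program[of 7, unfolded greedy_program_nth lookup_body_def Let_def
  linear_rec_def, simplified]
lemmas run_update = run_greedy_program[of 8, unfolded greedy_program_nth update_body_def Let_def
  linear_rec_def, simplified]

lemma run_lookup_enc:
  "run greedy_program 7 (Cell (enc_list enc_entry bs) (Num i)) =
   (if i < length bs then enc_entry (bs ! i) else Num 0)"
proof (induction bs arbitrary: i)
  case Nil
  show ?case by (subst run_lookup) simp
next
  case (Cons x bs)
  then show ?case by (subst run_lookup) (cases i; simp)
qed

lemma run_update_enc:
  "run greedy_program 8 (Cell (enc_list enc_entry bs) (Cell (Num i) (enc_entry v))) =
   enc_list enc_entry (bs[i := v])"
proof (induction bs arbitrary: i)
  case Nil
  show ?case by (subst run_update) simp
next
  case (Cons x bs)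
  then show ?case by (subst run_update) (cases i; simp)
qed

lemma enc_literal_pair: "enc_literal (i, v) = Cell (Num i) (enc_bool v)"
  by (simp add: enc_literal_def)

lemma run_negated_enc:
  "run greedy_program 6 (Cell (enc_list enc_literal C) (enc_literal l)) =
   enc_bool ((fst l, \<not> snd l) \<in> set C)"
proof (induction C)
  case Nil
  show ?case by (subst run_negated) (simp add: enc_bool_def)
next
  case (Cons m C)
  obtain i v where m: "m = (i, v)" by force
  obtain j w where l: "l = (j, w)" by force
  from Cons show ?case unfolding m l
    by (subst run_negated) (cases v; cases w; auto simp: enc_bool_def enc_literal_pair)
qed

section \<open>CDNF formulas\<close>

text \<open>
  The flag \<open>w\<close> is \<open>True\<close> for clauses and \<open>False\<close> for terms. A clause is dead if it is satisfied by
  \<open>b\<close> or tautological, a term if it is falsified by \<open>b\<close> or contradictory; so \<open>b\<close> is a certificate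
  for \<open>w\<close> iff no clause (term) is live.
\<close>

definition dead :: "bool \<Rightarrow> partial_assignment \<Rightarrow> literal list \<Rightarrow> bool" where
  "dead w b C \<longleftrightarrow> (\<exists>l\<in>set C. b (fst l) = Some (snd l = w) \<or> (fst l, \<not> snd l) \<in> set C)"

definition live :: "bool \<Rightarrow> literal list list \<Rightarrow> partial_assignment \<Rightarrow> nat" where
  "live w \<phi> b = length (filter (\<lambda>C. \<not> dead w b C) \<phi>)"

definition potential :: "sbfe_instance \<Rightarrow> partial_assignment \<Rightarrow> nat" where
  "potential I b = live True (cnf I) b * live False (dnf I) b"

lemma live_simps [simp]:
  "live w [] b = 0" "live w (C # \<phi>) b = (if dead w b C then 0 else 1) + live w \<phi> b"
  by (simp_all add: live_def)

lemma dead_observe: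
  "b i = None \<Longrightarrow> dead w (b(i \<mapsto> v)) C \<longleftrightarrow> dead w b C \<or> (i, v = w) \<in> set C"
  unfolding dead_def by force

lemma dead_mono: "b \<subseteq>\<^sub>m b' \<Longrightarrow> dead w b C \<Longrightarrow> dead w b' C"
  unfolding dead_def map_le_def dom_def by force

lemma live_antimono: "b \<subseteq>\<^sub>m b' \<Longrightarrow> live w \<phi> b' \<le> live w \<phi> b"
  by (induction \<phi>) (auto dest: dead_mono)

lemma map_le_observe: "b i = None \<Longrightarrow> b \<subseteq>\<^sub>m b(i \<mapsto> v)"
  by (auto simp: map_le_def)

lemma map_le_observe_both: "b \<subseteq>\<^sub>m b' \<Longrightarrow> b(i \<mapsto> v) \<subseteq>\<^sub>m b'(i \<mapsto> v)"
  by (auto simp: map_le_def)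

text \<open>A clause dies at an outcome of \<open>i\<close> iff it was live and contains the literal
  in question; the further observations in \<open>b'\<close> leave fewer clauses to die. The
  additive form avoids truncated subtraction.\<close>

lemma live_submodular:
  assumes "b \<subseteq>\<^sub>m b'" "b' i = None"
  shows "live w \<phi> b' + live w \<phi> (b(i \<mapsto> v)) \<le> live w \<phi> b + live w \<phi> (b'(i \<mapsto> v))"
proof -
  have "b i = None" using assms by (auto simp: map_le_def dom_def)
  then show ?thesis using dead_mono[OF assms(1), of w] assms(2)
    by (induction \<phi>) (auto simp: dead_observe)
qed

lemma live_observe_less:
  assumes "b i = None" "C \<in> set \<phi>" "\<not> dead w b C" "(i, v = w) \<in> set C"
  shows "live w \<phi> (b(i \<mapsto> v)) < live w \<phi> b"
  using assms(2)
proof (induction \<phi>)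
  case (Cons D \<phi>)
  have "live w \<phi> (b(i \<mapsto> v)) \<le> live w \<phi> b"
    by (rule live_antimono[OF map_le_observe[of b i, OF assms(1)]])
  with Cons assms show ?case by (auto simp: dead_observe simp del: fun_upd_apply)
qed simp

lemma not_dead_iff:
  assumes "\<forall>l\<in>set C. fst l < n"
  shows "\<not> dead w b C \<longleftrightarrow> (\<exists>a. agrees n a b \<and> (\<forall>l\<in>set C. a (fst l) \<noteq> (snd l = w)))"
proof
  assume nd: "\<not> dead w b C"
  \<comment> \<open>Unobserved literals are made false for a clause and true for a term, which is
    consistent because \<open>C\<close> has no complementary literals.\<close>
  define a where "a i = (case b i of Some v \<Rightarrow> v | None \<Rightarrow> (i, w) \<notin> set C)" for i
  have "a (fst l) \<noteq> (snd l = w)" if "l \<in> set C" for l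
  proof (cases "b (fst l)")
    case None
    have "(fst l, \<not> snd l) \<notin> set C" "(fst l, snd l) \<in> set C"
      using nd that unfolding dead_def by auto
    then have "(fst l, w) \<in> set C \<longleftrightarrow> snd l = w" by (cases "snd l = w") auto
    with None show ?thesis by (simp add: a_def)
  next
    case (Some v)
    then show ?thesis using nd that unfolding dead_def a_def by auto
  qed
  moreover have "agrees n a b" by (auto simp: agrees_def a_def)
  ultimately show "\<exists>a. agrees n a b \<and> (\<forall>l\<in>set C. a (fst l) \<noteq> (snd l = w))" by blast
next
  assume "\<exists>a. agrees n a b \<and> (\<forall>l\<in>set C. a (fst l) \<noteq> (snd l = w))"
  then obtain a where "agrees n a b" and a: "\<forall>l\<in>set C. a (fst l) \<noteq> (snd l = w)" by blast
  show "\<not> dead w b C"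
  proof
    assume "dead w b C"
    then obtain i v where l: "(i, v) \<in> set C" and "b i = Some (v = w) \<or> (i, \<not> v) \<in> set C"
      unfolding dead_def by auto
    then consider "b i = Some (v = w)" | "(i, \<not> v) \<in> set C" by blast
    then show False
    proof cases
      case 1
      then have "a i = (v = w)" using \<open>agrees n a b\<close> assms l unfolding agrees_def by fastforce
      with a l show False by fastforce
    next
      case 2
      with a l have "a i \<noteq> (v = w)" "a i \<noteq> ((\<not> v) = w)" by fastforce+
      then show False by blast
    qed
  qed
qed

lemma live_eq_0_iff: "live w \<phi> b = 0 \<longleftrightarrow> (\<forall>C\<in>set \<phi>. dead w b C)"
  by (auto simp: live_def filter_empty_conv)

text \<open>All completions satisfy a CNF iff they all satisfy each clause, so the check can be made
  clause by clause.\<close>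

lemma certificate_True_iff:
  assumes "cdnf_instance I"
  shows "certificate (num_vars I) (fun_of I) True b \<longleftrightarrow> live True (cnf I) b = 0"
proof -
  have "dead True b C \<longleftrightarrow> (\<forall>a. agrees (num_vars I) a b \<longrightarrow> (\<exists>l\<in>set C. lit_true a l))"
    if "C \<in> set (cnf I)" for C
    using not_dead_iff[of C "num_vars I" True b] assms that
    by (auto simp: cdnf_instance_def lit_true_def)
  then show ?thesis
    unfolding live_eq_0_iff certificate_def fun_of_def eval_cnf_def by blast
qed

text \<open>Dually, all completions falsify a DNF iff they all falsify each term; this is where both
  formulas must represent the same function.\<close>

lemma certificate_False_iff:
  assumes "cdnf_instance I"
  shows "certificate (num_vars I) (fun_of I) False b \<longleftrightarrow> live False (dnf I) b = 0"
proof -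
  have "dead False b C \<longleftrightarrow> (\<forall>a. agrees (num_vars I) a b \<longrightarrow> (\<exists>l\<in>set C. \<not> lit_true a l))"
    if "C \<in> set (dnf I)" for C
    using not_dead_iff[of C "num_vars I" False b] assms that
    by (auto simp: cdnf_instance_def lit_true_def)
  moreover have "fun_of I = eval_dnf (dnf I)"
    using assms by (auto simp: cdnf_instance_def fun_of_def)
  ultimately show ?thesis
    unfolding live_eq_0_iff certificate_def eval_dnf_def by auto
qed

text \<open>The literals \<open>C\<close> still to be scanned are kept apart from the whole clause
  \<open>D\<close> for the induction.\<close>

lemma run_dead_enc:
  assumes "\<forall>l\<in>set C. fst l < n"
  shows "run greedy_program 5 (Cell (enc_list enc_literal C)
      (Cell (enc_list enc_literal D) (Cell (enc_bool w) (enc_partial n b)))) =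
    enc_bool (\<exists>l\<in>set C. b (fst l) = Some (snd l = w) \<or> (fst l, \<not> snd l) \<in> set D)"
  using assms
proof (induction C)
  case Nil
  show ?case by (subst run_dead) (simp add: enc_bool_def)
next
  case (Cons l C)
  obtain i v where l: "l = (i, v)" by force
  have look: "run greedy_program 7 (Cell (enc_partial n b) (Num i)) = enc_entry (b i)"
    using Cons.prems l by (simp add: enc_partial_def run_lookup_enc)
  have neg: "run greedy_program 6 (Cell (enc_list enc_literal D) (Cell (Num i) (enc_bool v))) =
      enc_bool ((i, \<not> v) \<in> set D)"
    using run_negated_enc[of D "(i, v)"] by (simp add: enc_literal_def)
  have entry: "enc_entry x = Num (case x of None \<Rightarrow> 0 | Some False \<Rightarrow> 1 | Some True \<Rightarrow> 2)" for x
    by (cases x rule: enc_entry.cases) auto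
  from Cons l neg show ?case
    by (subst run_dead) (cases v; cases w; cases "b i" rule: enc_entry.cases;
      auto simp: enc_literal_pair look enc_bool_def entry)
qed

lemma run_live_enc:
  assumes "\<forall>C\<in>set \<phi>. \<forall>l\<in>set C. fst l < n"
  shows "run greedy_program 4 (Cell (enc_list (enc_list enc_literal) \<phi>)
      (Cell (enc_bool w) (enc_partial n b))) = Num (live w \<phi> b)"
  using assms
proof (induction \<phi>)
  case Nil
  show ?case by (subst run_live) simp
next
  case (Cons C \<phi>)
  then have "run greedy_program 5 (Cell (enc_list enc_literal C)
      (Cell (enc_list enc_literal C) (Cell (enc_bool w) (enc_partial n b)))) = enc_bool (dead w b C)"
    unfolding dead_def by (intro run_dead_enc) auto
  with Cons show ?case by (subst run_live) (auto simp: enc_bool_def)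
qed

definition enc_formulas :: "sbfe_instance \<Rightarrow> val" where
  "enc_formulas I =
     Cell (enc_list (enc_list enc_literal) (cnf I)) (enc_list (enc_list enc_literal) (dnf I))"

lemma run_live_instance:
  assumes "cdnf_instance I"
  shows "run greedy_program 4 (Cell (enc_list (enc_list enc_literal) (cnf I))
      (Cell (Num 1) (enc_partial (num_vars I) b))) = Num (live True (cnf I) b)"
    and "run greedy_program 4 (Cell (enc_list (enc_list enc_literal) (dnf I))
      (Cell (Num 0) (enc_partial (num_vars I) b))) = Num (live False (dnf I) b)"
  using assms run_live_enc[of "cnf I" "num_vars I" True b] run_live_enc[of "dnf I" "num_vars I" False b]
  by (simp_all add: cdnf_instance_def enc_bool_def)

lemma run_potential_enc:
  assumes "cdnf_instance I"
  shows "run greedy_program 3 (Cell (enc_formulas I) (enc_partial (num_vars I) b)) =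
    Num (potential I b)"
  using run_live_instance[OF assms, of b]
  by (subst run_potential) (simp add: enc_formulas_def potential_def)

definition nat_frac :: "rat \<Rightarrow> nat \<times> nat" where
  "nat_frac q = (nat (fst (quotient_of q)), nat (snd (quotient_of q)))"

lemma enc_rat_nat_frac: "enc_rat q = Cell (Num (fst (nat_frac q))) (Num (snd (nat_frac q)))"
  by (simp add: enc_rat_def nat_frac_def)

lemma nat_frac:
  assumes "0 \<le> q"
  shows "0 < snd (nat_frac q)" "real_of_rat q * snd (nat_frac q) = fst (nat_frac q)"
proof -
  obtain a d where ad: "quotient_of q = (a, d)" by force
  then have d: "0 < d" and q: "q = of_int a / of_int d"
    using quotient_of_denom_pos quotient_of_div by auto
  with assms have "0 \<le> a" by (simp add: zero_le_divide_iff)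
  then show "0 < snd (nat_frac q)" "real_of_rat q * snd (nat_frac q) = fst (nat_frac q)"
    using d unfolding q[symmetric] by (simp_all add: nat_frac_def ad) (simp add: q of_rat_divide)
qed

text \<open>The cost and the gain of testing \<open>i\<close>, both multiplied by the denominators of the cost and of
  the probability.\<close>

definition scaled_cost :: "sbfe_instance \<Rightarrow> nat \<Rightarrow> nat" where
  "scaled_cost I i = fst (nat_frac (costs I ! i)) * snd (nat_frac (probs I ! i))"

definition scaled_gain :: "sbfe_instance \<Rightarrow> partial_assignment \<Rightarrow> nat \<Rightarrow> nat" where
  "scaled_gain I b i = (if b i = None then
     snd (nat_frac (costs I ! i)) *
       (fst (nat_frac (probs I ! i)) * (potential I b - potential I (b(i \<mapsto> True))) +
       (snd (nat_frac (probs I ! i)) - fst (nat_frac (probs I ! i))) *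
         (potential I b - potential I (b(i \<mapsto> False))))
     else 0)"

lemma map_upt_update: "i < n \<Longrightarrow> (map b [0..<n])[i := v] = map (b(i := v)) [0..<n]"
  by (auto simp: list_eq_iff_nth_eq nth_list_update)

lemma run_score_enc:
  assumes I: "cdnf_instance I" and i: "i < num_vars I"
  shows "run greedy_program 2 (Cell (Cell (enc_rat (probs I ! i)) (enc_rat (costs I ! i)))
      (Cell (Num i) (Cell (enc_formulas I) (enc_partial (num_vars I) b)))) =
    Cell (Num (scaled_cost I i)) (Num (scaled_gain I b i))"
proof -
  let ?n = "num_vars I"
  have upd: "run greedy_program 8 (Cell (enc_partial ?n b) (Cell (Num i) (enc_entry (Some v)))) =
      enc_partial ?n (b(i \<mapsto> v))" for v
    using i by (simp only: enc_partial_def run_update_enc map_upt_update)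
  have look: "run greedy_program 7 (Cell (enc_partial ?n b) (Num i)) = enc_entry (b i)"
    using i by (simp add: enc_partial_def run_lookup_enc)
  have entry: "enc_entry x = Num 0 \<longleftrightarrow> x = None" for x
    by (cases x rule: enc_entry.cases) auto
  show ?thesis
    by (subst run_score) (simp add: look entry enc_rat_nat_frac scaled_cost_def scaled_gain_def
        run_potential_enc[OF I] upd[of True, simplified] upd[of False, simplified])
qed

text \<open>The cross-multiplied comparison is transitive only through a positive gain, which can be
  cancelled. Hence variables of gain 0 are never candidates; they satisfy the inequality
  trivially.\<close>

lemma run_best_enc:
  fixes b :: partial_assignment
  assumes I: "cdnf_instance I" and k: "k \<le> num_vars I"
  defines "v \<equiv> run greedy_program 1 (Cell (Cell (enc_list enc_rat (drop k (probs I)))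
      (enc_list enc_rat (drop k (costs I))))
      (Cell (Num k) (Cell (enc_formulas I) (enc_partial (num_vars I) b))))"
  shows "(v = Num 0 \<and> (\<forall>i. k \<le> i \<longrightarrow> i < num_vars I \<longrightarrow> scaled_gain I b i = 0)) \<or>
    (\<exists>j. k \<le> j \<and> j < num_vars I \<and> 0 < scaled_gain I b j \<and>
      v = Cell (Num j) (Cell (Num (scaled_cost I j)) (Num (scaled_gain I b j))) \<and>
      (\<forall>i. k \<le> i \<longrightarrow> i < num_vars I \<longrightarrow>
        scaled_cost I j * scaled_gain I b i \<le> scaled_cost I i * scaled_gain I b j))"
  using k unfolding v_def
proof (induction k rule: inc_induct)
  case base
  then show ?case using I
    unfolding One_nat_def by (subst run_best) (simp add: num_vars_def cdnf_instance_def)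
next
  case (step k)
  let ?X = "scaled_cost I" and ?Y = "scaled_gain I b" and ?n = "num_vars I"
  let ?ctx = "Cell (enc_formulas I) (enc_partial ?n b)"
  let ?v = "\<lambda>k. run greedy_program 1 (Cell (Cell (enc_list enc_rat (drop k (probs I)))
      (enc_list enc_rat (drop k (costs I)))) (Cell (Num k) ?ctx))"
  have len: "k < length (probs I)" "k < length (costs I)"
    using step.hyps I by (simp_all add: num_vars_def cdnf_instance_def)
  have drop: "drop k (probs I) = probs I ! k # drop (Suc k) (probs I)"
    "drop k (costs I) = costs I ! k # drop (Suc k) (costs I)"
    using len by (simp_all add: Cons_nth_drop_Suc)
  let ?r = "?v (Suc k)" and ?new = "Cell (Num k) (Cell (Num (?X k)) (Num (?Y k)))"
  have v: "?v k = (if ?Y k = 0 then ?r else if apply1 IsCell ?r \<noteq> Num 0 then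
      (if ?X k * num (apply1 Second (apply1 Second ?r)) \<le> num (apply1 First (apply1 Second ?r)) * ?Y k
       then ?new else ?r) else ?new)"
    unfolding drop One_nat_def by (subst run_best) (simp add: run_score_enc[OF I] step.hyps)
  have range: "(\<forall>i. k \<le> i \<longrightarrow> i < ?n \<longrightarrow> Q i) \<longleftrightarrow> Q k \<and> (\<forall>i. Suc k \<le> i \<longrightarrow> i < ?n \<longrightarrow> Q i)" for Q
    using step.hyps by (metis Suc_leD Suc_leI le_eq_less_or_eq order_refl)
  from step.IH show ?case
  proof (elim disjE conjE exE)
    assume r: "?r = Num 0" and 0: "\<forall>i. Suc k \<le> i \<longrightarrow> i < ?n \<longrightarrow> ?Y i = 0"
    show ?thesis
    proof (cases "?Y k = 0")
      case True
      then show ?thesis unfolding v range using r 0 by simp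
    next
      case False
      then have "?v k = ?new" unfolding v using r by simp
      moreover have "\<forall>i. k \<le> i \<longrightarrow> i < ?n \<longrightarrow> ?X k * ?Y i \<le> ?X i * ?Y k"
        unfolding range using 0 by simp
      ultimately show ?thesis using False step.hyps by blast
    qed
  next
    fix j
    assume j: "Suc k \<le> j" "j < ?n" "0 < ?Y j"
      and r: "?r = Cell (Num j) (Cell (Num (?X j)) (Num (?Y j)))"
      and best: "\<forall>i. Suc k \<le> i \<longrightarrow> i < ?n \<longrightarrow> ?X j * ?Y i \<le> ?X i * ?Y j"
    show ?thesis
    proof (cases "?Y k \<noteq> 0 \<and> ?X k * ?Y j \<le> ?X j * ?Y k")
      case True
      then have "?v k = ?new" unfolding v using r by simp
      moreover have "?X k * ?Y i \<le> ?X i * ?Y k" if "Suc k \<le> i" "i < ?n" for i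
      proof -
        have "(?X k * ?Y i) * ?Y j = (?X k * ?Y j) * ?Y i" by simp
        also have "\<dots> \<le> (?X j * ?Y k) * ?Y i" using True by (intro mult_right_mono) auto
        also have "\<dots> = (?X j * ?Y i) * ?Y k" by simp
        also have "\<dots> \<le> (?X i * ?Y j) * ?Y k" using best that by (intro mult_right_mono) auto
        finally have "(?X k * ?Y i) * ?Y j \<le> (?X i * ?Y k) * ?Y j" by (simp add: ac_simps)
        then show ?thesis using j(3) by simp
      qed
      then have "\<forall>i. k \<le> i \<longrightarrow> i < ?n \<longrightarrow> ?X k * ?Y i \<le> ?X i * ?Y k"
        unfolding range by simp
      ultimately show ?thesis using True step.hyps by blast
    next
      case False
      then have "?v k = ?r" unfolding v using r by auto
      moreover have "\<forall>i. k \<le> i \<longrightarrow> i < ?n \<longrightarrow> ?X j * ?Y i \<le> ?X i * ?Y j"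
        unfolding range using best False by auto
      ultimately show ?thesis using j r Suc_leD by metis
    qed
  qed
qed

section \<open>The potential as an instance of submodular cover\<close>

lemma potential_mono: "b i = None \<Longrightarrow> potential I (b(i \<mapsto> v)) \<le> potential I b"
  unfolding potential_def by (intro mult_mono live_antimono map_le_observe) auto

text \<open>Discrete product rule: the drop of \<open>U * T\<close> is the drop of \<open>U\<close>
  times the old \<open>T\<close> plus the new \<open>U\<close> times the drop of \<open>T\<close>.
  All four factors are nonnegative and can only shrink as observations are added.\<close>

lemma potential_submodular:
  assumes "b \<subseteq>\<^sub>m b'" "b' i = None"
  shows "real (potential I b') - real (potential I (b'(i \<mapsto> v)))
    \<le> real (potential I b) - real (potential I (b(i \<mapsto> v)))"
proof -
  define U T where "U x = real (live True (cnf I) x)" and "T x = real (live False (dnf I) x)" for x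
  have bi: "b i = None" using assms by (auto simp: map_le_def dom_def)
  have split: "real (potential I x) - real (potential I (x(i \<mapsto> v)))
      = (U x - U (x(i \<mapsto> v))) * T x + U (x(i \<mapsto> v)) * (T x - T (x(i \<mapsto> v)))" for x
    by (simp add: potential_def U_def T_def algebra_simps)
  have sub: "U b' - U (b'(i \<mapsto> v)) \<le> U b - U (b(i \<mapsto> v))" "T b' - T (b'(i \<mapsto> v)) \<le> T b - T (b(i \<mapsto> v))"
    using live_submodular[OF assms, of True "cnf I" v] live_submodular[OF assms, of False "dnf I" v]
    unfolding U_def T_def by linarith+
  have anti: "U y \<le> U x" "T y \<le> T x" if "x \<subseteq>\<^sub>m y" for x y
    using live_antimono[OF that] by (simp_all add: U_def T_def)
  show ?thesis
    unfolding split
    using sub anti[OF assms(1)] anti[OF map_le_observe_both[OF assms(1)], of i v]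
      anti[OF map_le_observe[of b i v, OF bi]] anti[OF map_le_observe[of b' i v, OF assms(2)]]
    by (intro add_mono mult_mono) (auto simp: U_def T_def)
qed

definition greedy_answer :: "sbfe_instance \<Rightarrow> partial_assignment \<Rightarrow> val" where
  "greedy_answer I b = run greedy_program 0 (Cell (enc_instance I) (enc_partial (num_vars I) b))"

section \<open>The program on a fixed instance\<close>

context
  fixes I :: sbfe_instance
  assumes I: "cdnf_instance I"
begin

lemma prob_of_bounds: "i < num_vars I \<Longrightarrow> 0 < prob_of I i \<and> prob_of I i < 1"
  using I by (auto simp: cdnf_instance_def prob_of_def num_vars_def)

lemma cost_of_nonneg: "i < num_vars I \<Longrightarrow> 0 \<le> cost_of I i"
  using I by (auto simp: cdnf_instance_def cost_of_def)

interpretation adaptive_cover "num_vars I" "prob_of I" "cost_of I" "potential I"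
  by unfold_locales (use prob_of_bounds cost_of_nonneg potential_mono potential_submodular in auto)

lemma scaled_cost_eq:
  assumes "i < num_vars I"
  shows "real (scaled_cost I i) =
    (snd (nat_frac (costs I ! i)) * snd (nat_frac (probs I ! i))) * cost_of I i"
proof -
  have "real_of_rat (costs I ! i) * snd (nat_frac (costs I ! i)) = fst (nat_frac (costs I ! i))"
    using assms I by (intro nat_frac(2)) (simp add: cdnf_instance_def)
  from this[symmetric] show ?thesis by (simp add: scaled_cost_def cost_of_def)
qed

text \<open>Cost and gain of \<open>i\<close> carry the same factor, so ratios are preserved. The
  truncated subtractions are exact: the numerator of a probability is at most its denominator, and
  the potential does not grow.\<close>

lemma scaled_gain_eq:
  assumes "i < num_vars I" "b i = None"
  shows "real (scaled_gain I b i) =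
    (snd (nat_frac (costs I ! i)) * snd (nat_frac (probs I ! i))) * gain b i"
proof -
  let ?a = "fst (nat_frac (probs I ! i))" and ?e = "snd (nat_frac (probs I ! i))"
  have p: "0 \<le> probs I ! i" "probs I ! i < 1"
    using I assms(1) by (auto simp: cdnf_instance_def num_vars_def less_imp_le)
  have e: "prob_of I i * ?e = ?a" "0 < ?e"
    using nat_frac[OF p(1)] by (simp_all add: prob_of_def)
  then have "real ?a \<le> real ?e"
    using prob_of_bounds[OF assms(1)] mult_right_mono[of "prob_of I i" 1 "real ?e"] by simp
  then have le: "?a \<le> ?e" by simp
  have "real (scaled_gain I b i) = snd (nat_frac (costs I ! i)) *
      (real ?a * (real (potential I b) - real (potential I (b(i \<mapsto> True)))) +
       (real ?e - real ?a) * (real (potential I b) - real (potential I (b(i \<mapsto> False)))))"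
    using assms(2) le potential_mono[of b i I] by (simp add: scaled_gain_def of_nat_diff)
  then show ?thesis
    by (simp add: gain_def mean_def algebra_simps flip: e(1))
qed

text \<open>Extend \<open>b\<close> to some \<open>a\<close> of value 1 and take a live clause:
  \<open>a\<close> satisfies it by a literal on an untested \<open>i\<close>, and the outcome
  \<open>a i\<close>, of positive probability, kills it. Since a term is live as well, the product
  drops.\<close>

lemma exists_gain:
  assumes "\<not> certificate (num_vars I) (fun_of I) False b" "\<not> certificate (num_vars I) (fun_of I) True b"
  shows "\<exists>i<num_vars I. b i = None \<and> 0 < gain b i"
proof -
  from assms(2) certificate_True_iff[OF I, of b] obtain C where
    C: "C \<in> set (cnf I)" "\<not> dead True b C" by (auto simp: live_eq_0_iff)
  from assms(1) obtain a where a: "agrees (num_vars I) a b" "fun_of I a"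
    by (auto simp: certificate_def)
  with C obtain l where l: "l \<in> set C" "lit_true a l" by (auto simp: fun_of_def eval_cnf_def)
  obtain i v where "l = (i, v)" by force
  with l have iv: "(i, v) \<in> set C" "a i = v" by (simp_all add: lit_true_def)
  have i: "i < num_vars I" using I C iv by (fastforce simp: cdnf_instance_def)
  have bi: "b i = None"
  proof (cases "b i")
    case (Some w)
    with a i iv have "w = v" by (auto simp: agrees_def)
    with Some C iv show ?thesis by (force simp: dead_def)
  qed
  have "live True (cnf I) (b(i \<mapsto> v)) < live True (cnf I) b"
    using iv by (intro live_observe_less[OF bi C]) simp
  moreover have "live False (dnf I) (b(i \<mapsto> v)) \<le> live False (dnf I) b"
    by (intro live_antimono map_le_observe bi)
  moreover have "0 < live False (dnf I) b"
    using assms(1) certificate_False_iff[OF I] by simp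
  ultimately have "potential I (b(i \<mapsto> v)) < potential I b"
    unfolding potential_def by (meson le_less_trans mult_le_mono2 mult_less_mono1)
  moreover have "potential I (b(i \<mapsto> w)) \<le> potential I b" for w by (rule potential_mono[of b i, OF bi])
  ultimately have "0 < gain b i"
    unfolding gain_def mean_def using prob_of_bounds[OF i]
    by (cases v) (auto intro: add_pos_nonneg add_nonneg_pos)
  with i bi show ?thesis by blast
qed

lemma greedy_answer:
  shows "certificate (num_vars I) (fun_of I) True b \<Longrightarrow> greedy_answer I b = enc_action (Output True)"
    and "certificate (num_vars I) (fun_of I) False b \<Longrightarrow> greedy_answer I b = enc_action (Output False)"
    and "\<not> certificate (num_vars I) (fun_of I) True b \<Longrightarrow>
      \<not> certificate (num_vars I) (fun_of I) False b \<Longrightarrow>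
      \<exists>j<num_vars I. b j = None \<and> greedy_answer I b = enc_action (Query j) \<and>
        (\<forall>i<num_vars I. b i = None \<longrightarrow> cost_of I j * gain b i \<le> cost_of I i * gain b j)"
proof -
  let ?n = "num_vars I" and ?U = "live True (cnf I) b" and ?T = "live False (dnf I) b"
  let ?best = "run greedy_program 1 (Cell (Cell (enc_list enc_rat (probs I)) (enc_list enc_rat (costs I)))
      (Cell (Num 0) (Cell (enc_formulas I) (enc_partial ?n b))))"
  have v: "greedy_answer I b = (if ?U \<noteq> 0 then if ?T \<noteq> 0 then Cell (Num 0) (apply1 First ?best)
      else enc_action (Output False) else enc_action (Output True))"
    unfolding greedy_answer_def using run_live_instance[OF I, of b]
    by (subst run_main) (simp add: enc_instance_def enc_formulas_def enc_bool_def)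
  show "certificate ?n (fun_of I) True b \<Longrightarrow> greedy_answer I b = enc_action (Output True)"
    using v certificate_True_iff[OF I, of b] by simp
  show "greedy_answer I b = enc_action (Output False)" if F: "certificate ?n (fun_of I) False b"
  proof -
    \<comment> \<open>No observation certifies both values, because it has a completion; so the
      program passes its first check.\<close>
    have "\<not> certificate ?n (fun_of I) True b"
    proof -
      have "agrees ?n (\<lambda>i. case b i of Some v \<Rightarrow> v | None \<Rightarrow> False) b" by (auto simp: agrees_def)
      with F show ?thesis unfolding certificate_def by blast
    qed
    with F show ?thesis
      using v certificate_True_iff[OF I, of b] certificate_False_iff[OF I, of b] by simp
  qed
  assume nc: "\<not> certificate ?n (fun_of I) True b" "\<not> certificate ?n (fun_of I) False b"
  let ?s = "\<lambda>i. real (snd (nat_frac (costs I ! i)) * snd (nat_frac (probs I ! i)))"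
  have s: "0 < ?s i" if "i < ?n" for i
    using nat_frac(1)[of "costs I ! i"] nat_frac(1)[of "probs I ! i"] I that
    by (auto simp: cdnf_instance_def num_vars_def less_imp_le)
  have vb: "greedy_answer I b = Cell (Num 0) (apply1 First ?best)"
    using v nc certificate_True_iff[OF I, of b] certificate_False_iff[OF I, of b] by simp
  from exists_gain[OF nc(2,1)] obtain i where i: "i < ?n" "b i = None" "0 < gain b i" by blast
  then have "0 < real (scaled_gain I b i)" using s by (simp add: scaled_gain_eq)
  then have "\<exists>i. i < ?n \<and> scaled_gain I b i \<noteq> 0" using i by auto
  with run_best_enc[OF I, of 0 b] obtain j where j: "j < ?n" "0 < scaled_gain I b j"
    "apply1 First ?best = Num j"
    "\<And>i. i < ?n \<Longrightarrow> scaled_cost I j * scaled_gain I b i \<le> scaled_cost I i * scaled_gain I b j"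
    by auto
  from j(2) have bj: "b j = None" by (auto simp: scaled_gain_def split: if_splits)
  have "cost_of I j * gain b i \<le> cost_of I i * gain b j" if i: "i < ?n" "b i = None" for i
  proof -
    have "real (scaled_cost I j) * real (scaled_gain I b i)
        \<le> real (scaled_cost I i) * real (scaled_gain I b j)"
      using j(4)[OF i(1)] by (simp flip: of_nat_mult)
    then have "(?s i * ?s j) * (cost_of I j * gain b i) \<le> (?s i * ?s j) * (cost_of I i * gain b j)"
      unfolding scaled_cost_eq[OF i(1)] scaled_cost_eq[OF j(1)]
        scaled_gain_eq[of i b, OF i] scaled_gain_eq[of j b, OF j(1) bj]
      by (simp only: ac_simps)
    then show ?thesis
      using mult_pos_pos[OF s[OF i(1)] s[OF j(1)]] by (simp only: mult_le_cancel_left_pos)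
  qed
  with j bj vb show "\<exists>j<?n. b j = None \<and> greedy_answer I b = enc_action (Query j) \<and>
      (\<forall>i<?n. b i = None \<longrightarrow> cost_of I j * gain b i \<le> cost_of I i * gain b j)"
    by auto
qed

lemma executes_greedy:
  assumes B: "\<And>b. computes_within greedy_program (Cell (enc_instance I) (enc_partial (num_vars I) b))
    (greedy_answer I b) B"
  shows "\<exists>T. executes greedy_program B I b T \<and> strategy_from (num_vars I) (fun_of I) b T \<and> greedy b T"
proof (induction "card {i. i < num_vars I \<and> b i = None}" arbitrary: b rule: less_induct)
  case less
  let ?cert = "\<lambda>v. certificate (num_vars I) (fun_of I) v b"
  consider v where "?cert v" | "\<not> ?cert True" "\<not> ?cert False" by blast
  then show ?case
  proof cases
    case (1 v)
    then have "executes greedy_program B I b (Leaf v)"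
      using B[of b] greedy_answer(1,2)[of b] by (cases v) (auto intro: executes_Leaf)
    with 1 show ?thesis by (intro exI[of _ "Leaf v"]) simp
  next
    case 2
    from greedy_answer(3)[OF this] obtain j where j: "j < num_vars I" "b j = None"
      and run: "greedy_answer I b = enc_action (Query j)"
      and choice: "\<forall>i<num_vars I. b i = None \<longrightarrow> cost_of I j * gain b i \<le> cost_of I i * gain b j"
      by blast
    have "\<exists>T. executes greedy_program B I (b(j \<mapsto> v)) T \<and>
        strategy_from (num_vars I) (fun_of I) (b(j \<mapsto> v)) T \<and> greedy (b(j \<mapsto> v)) T" for v
    proof (rule less)
      have "{i. i < num_vars I \<and> (b(j \<mapsto> v)) i = None} \<subset> {i. i < num_vars I \<and> b i = None}"
        using j by (auto simp: fun_upd_apply)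
      then show "card {i. i < num_vars I \<and> (b(j \<mapsto> v)) i = None} < card {i. i < num_vars I \<and> b i = None}"
        by (intro psubset_card_mono) auto
    qed
    then obtain l r where
      l: "executes greedy_program B I (b(j \<mapsto> False)) l"
        "strategy_from (num_vars I) (fun_of I) (b(j \<mapsto> False)) l" "greedy (b(j \<mapsto> False)) l" and
      r: "executes greedy_program B I (b(j \<mapsto> True)) r"
        "strategy_from (num_vars I) (fun_of I) (b(j \<mapsto> True)) r" "greedy (b(j \<mapsto> True)) r"
      by metis
    have "executes greedy_program B I b (Test j l r)"
      using B[of b] l r unfolding run by (intro executes_Test)
    moreover have "0 < potential I b"
      using 2 certificate_True_iff[OF I, of b] certificate_False_iff[OF I, of b]
      by (simp add: potential_def)
    ultimately show ?thesis
      using 2 j l r choice by (intro exI[of _ "Test j l r"]) simp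
  qed
qed

lemma strategy_covers:
  "strategy_from (num_vars I) (fun_of I) b T \<Longrightarrow> covers b T"
proof (induction T arbitrary: b)
  case (Leaf v)
  then have "potential I b = 0"
    using certificate_True_iff[OF I, of b] certificate_False_iff[OF I, of b]
    by (cases v) (simp_all add: potential_def)
  then show ?case by simp
qed simp

lemma greedy_approximation:
  assumes "strategy (num_vars I) (fun_of I) T" "greedy unobserved T"
  shows "expected_cost (num_vars I) (prob_of I) (cost_of I) T
    \<le> harm (length (cnf I) * length (dnf I)) *
      opt_cost (num_vars I) (fun_of I) (prob_of I) (cost_of I)"
proof -
  let ?cost = "expected_cost (num_vars I) (prob_of I) (cost_of I)"
  have local: "fun_of I a = fun_of I a'" if "\<forall>i<num_vars I. a i = a' i" for a a'
    using I that by (fastforce simp: cdnf_instance_def fun_of_def eval_cnf_def lit_true_def)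
  obtain S where S: "strategy (num_vars I) (fun_of I) S"
    "?cost S = opt_cost (num_vars I) (fun_of I) (prob_of I) (cost_of I)"
    by (rule opt_cost_attained[of "num_vars I" "fun_of I", OF local]) auto
  have cost: "?cost T' = residual_cost unobserved T'" if "strategy (num_vars I) (fun_of I) T'" for T'
    using expected_cost_residual_cost[of "fun_of I" unobserved T'] that
    by (simp add: strategy_def expected_cost_def)
  have cov: "covers unobserved S" using S(1) by (simp add: strategy_def strategy_covers)
  \<comment> \<open>The number of clauses times the number of terms enters only here.\<close>
  have "potential I unobserved \<le> length (cnf I) * length (dnf I)"
    unfolding potential_def live_def by (intro mult_mono) auto
  then have "harm (potential I unobserved) \<le> (harm (length (cnf I) * length (dnf I)) :: real)"
    by (rule harm_mono)
  with greedy_residual_cost[OF assms(2) cov] show ?thesis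
    unfolding S(2)[symmetric] cost[OF S(1)] cost[OF assms(1)]
    using residual_cost_nonneg[OF cov] by (meson mult_right_mono order_trans)
qed

end

section \<open>Input sizes and the growth of the approximation factor\<close>

lemma val_size_enc_partial: "val_size (enc_partial n b) \<le> 3 * n + 1"
proof -
  have "val_size (enc_entry x) \<le> 2" for x
    by (cases x rule: enc_entry.cases) (simp_all add: floor_log_zero floor_log.simps[of 2])
  then have "val_size (enc_list enc_entry bs) \<le> 3 * length bs + 1" for bs
    by (induction bs) (auto simp: floor_log_zero intro: order_trans[OF add_mono])
  from this[of "map b [0..<n]"] show ?thesis by (simp add: enc_partial_def)
qed

lemma length_le_val_size_enc_list: "length xs \<le> val_size (enc_list g xs)"
  by (induction xs) auto

text \<open>From \<open>m = 3 > e\<close> on,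
  \<open>harm m \<le> ln m + 1 \<le> 2 * ln m\<close>.\<close>

lemma harm_bigo_ln: "(\<lambda>m. harm m :: real) \<in> O(\<lambda>m. ln (real m))"
proof (rule bigoI[of _ 2])
  show "\<forall>\<^sub>F m in sequentially. norm (harm m :: real) \<le> 2 * norm (ln (real m))"
    using eventually_ge_at_top[of 3]
  proof eventually_elim
    case (elim m)
    have "1 \<le> ln (real m)"
      using elim exp_le ln_mono[of "exp 1" "real m"] by simp
    moreover have "harm m \<le> ln (real m) + (1 :: real)"
      using euler_mascheroni_sequence_decreasing[of 1 m] elim by (simp add: harm_expand)
    ultimately show ?case using harm_nonneg[of m, where 'a = real] by simp
  qed
qed

theorem theorem1:
  shows "\<exists>(P :: program) (\<gamma> :: nat \<Rightarrow> real).
           \<gamma> \<in> O(\<lambda>m. ln (real m)) \<and>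
           polytime_cdnf_approximation P (\<lambda>I. \<gamma> (length (cnf I) * length (dnf I)))"
proof (intro exI conjI)
  \<comment> \<open>The factor is \<open>harm\<close> itself: \<open>ln\<close> would give 0 for a
    single clause and a single term.\<close>
  show "(\<lambda>m. harm m :: real) \<in> O(\<lambda>m. ln (real m))" by (rule harm_bigo_ln)
  obtain q :: "nat poly" where
    q: "\<And>u. \<exists>t \<le> poly q (val_size u). eval greedy_program [u] (greedy_program ! 0) (run greedy_program 0 u) t"
    using polytime_main by (rule polytimeE) blast
  \<comment> \<open>With \<open>s\<close> the instance size, the argument has size at most
    \<open>s + (3 * s + 1) + 1\<close>, since the instance lists a probability for each
    variable.\<close>
  define Q where "Q = pcompose q [:2, 4:]"
  have "\<exists>T. executes greedy_program (poly Q (instance_size I)) I unobserved T \<and>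
      strategy (num_vars I) (fun_of I) T \<and>
      expected_cost (num_vars I) (prob_of I) (cost_of I) T
        \<le> harm (length (cnf I) * length (dnf I)) *
          opt_cost (num_vars I) (fun_of I) (prob_of I) (cost_of I)" if I: "cdnf_instance I" for I
  proof -
    have "computes_within greedy_program (Cell (enc_instance I) (enc_partial (num_vars I) b))
        (greedy_answer I b)
        (poly Q (instance_size I))" for b
    proof -
      let ?u = "Cell (enc_instance I) (enc_partial (num_vars I) b)"
      have "num_vars I \<le> instance_size I"
        using length_le_val_size_enc_list[of "probs I" enc_rat]
        by (simp add: num_vars_def instance_size_def enc_instance_def)
      then have "val_size ?u \<le> 2 + instance_size I * 4"
        using val_size_enc_partial[of "num_vars I" b] by (simp add: instance_size_def)
      then have "poly q (val_size ?u) \<le> poly Q (instance_size I)"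
        unfolding Q_def poly_pcompose by (intro poly_nat_mono) simp
      moreover have "greedy_program \<noteq> []" by (simp add: greedy_program_def)
      ultimately show ?thesis
        using q[of ?u] unfolding computes_within_def greedy_answer_def by (meson order_trans)
    qed
    from executes_greedy[OF I this] greedy_approximation[OF I] show ?thesis
      unfolding strategy_def by blast
  qed
  then show "polytime_cdnf_approximation greedy_program (\<lambda>I. harm (length (cnf I) * length (dnf I)))"
    unfolding polytime_cdnf_approximation_def by blast
qed

end
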